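(* Let $\mathcal G\rightrightarrows\mathbb{CP}(1)$ be the symplectic groupoid of the Bruhat sphere, in the coordinates $\mathbf x(z,w)$, $\dot{\mathbf x}(\dot z,\dot w)$ described in the context, and write $[1,0]^w_{\mathrm T}=\dot{\mathbf x}(0,w)$. Let $f,g\in C^\infty(\mathcal G)$ with $g$ compactly supported. Then one has the trace defect formula $${}_{\mathrm R}\!\int\big(f\circ g(x)-g\circ f(x)\big)\,\mu_{\mathrm M_0}(x)=-\pi\int_{\mathbb C}\big(\mathrm{Re}(w')\,\partial_{\dot x}+\mathrm{Im}(w')\,\partial_{\dot y}\big)\Big(f([1,0]^{\bar w'}_{\mathrm T})\,g([1,0]^{-\bar w'}_{\mathrm T})\Big)\,|dw'|^2 ,$$ where the derivatives in the integrand mean $\partial_{\dot x},\partial_{\dot y}$ at $\dot z=\dot x+i\dot y=0$ of the function $\dot z\mapsto f(\dot{\mathbf x}(\dot z,\bar w'))\,g(\dot{\mathbf x}(\dot z,-\bar w'))$.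
   Context: Groupoid. $\mathcal G=\mathrm T\backslash(\mathrm{SU}(2)\times\mathrm N)$ is the $4$-manifold covered by two charts $\mathbf x(z,w)$ and $\dot{\mathbf x}(\dot z,\dot w)$, each with domain $\mathbb C\times\mathbb C$, with transition (for $z\ne0$) $\mathbf x(z,w)=\dot{\mathbf x}\big(\tfrac1z,\tfrac{z^2}{|z|^2}w\big)$. It is a Lie groupoid over $\mathbb{CP}(1)$ with homogeneous coordinates: $\mathbf s(\mathbf x(z,w))=[z,1]$, $\mathbf t(\mathbf x(z,w))=[z+\bar w,1]$, product $\mathbf x(z+\bar w,w_1)\,\mathbf x(z,w)=\mathbf x(z,w+w_1)$, inverse $\mathbf x(z,w)^{-1}=\mathbf x(z+\bar w,-w)$, units $\mathbf x(z,0)$; $\mathbf s(\dot{\mathbf x}(\dot z,\dot w))=[1,\dot z]$, and over the point $[1,0]$ (the singular leaf) $\dot{\mathbf x}(0,w_1)\dot{\mathbf x}(0,w_2)=\dot{\mathbf x}(0,w_1+w_2)$, $\dot{\mathbf x}(0,w)^{-1}=\dot{\mathbf x}(0,-w)$, with unit $\dot{\mathbf x}(0,0)$. The open leaf is $\mathrm M_0=\{[z,1]:z\in\mathbb C\}$. Measures and convolution. $|dw|^2$ and $|dz|^2$ denote Lebesgue measure on $\mathbb C$. The invariant $\mathbf s$-fiberwise measure $\mu$ is $|dw|^2$ on the fibers in the chart $\mathbf x$ (equivalently $|d\dot w|^2$ in the chart $\dot{\mathbf x}$), and $\mu_{\mathrm M_0}=|dz|^2$. Convolution: $(f\circ g)(a)=\int_{b\in\mathbf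 s^{-1}(\mathbf s(a))}f(ab^{-1})g(b)\,\mu(b)$; $f\circ g(x)$ denotes its value at the unit at $x\in\mathbb{CP}(1)$, so for $x=[z,1]$, $f\circ g(x)=\int_{\mathbb C}f(\mathbf x(z+\bar w,-w))\,g(\mathbf x(z,w))\,|dw|^2$. Renormalized integral. For a smooth function $h$ on $\mathbb{CP}(1)$, the cutoff integral $\int_{|z|\le r_0}h([z,1])\,|dz|^2$ has an expansion $C_2r_0^2+C_1r_0+R\log r_0+C_0+O(r_0^{-1})$ as $r_0\to\infty$; the renormalized integral ${}_{\mathrm R}\!\int h\,\mu_{\mathrm M_0}$ is the constant term $C_0$. *)

theory Defs
  imports "HOL-Analysis.Analysis" "HOL-Real_Asymp.Real_Asymp"
begin

section \<open>The complex projective line\<close>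

text \<open>A partial quotient: the pair \<open>(0, 0)\<close> represents no point.\<close>

quotient_type cp1 = "complex \<times> complex" /
  partial: "\<lambda>(a, b) (c, d). (a, b) \<noteq> (0, 0) \<and> (c, d) \<noteq> (0, 0) \<and> a * d = b * c"
proof (rule part_equivpI)
  show "\<exists>p::complex \<times> complex. (\<lambda>(a, b) (c, d). (a, b) \<noteq> (0, 0) \<and> (c, d) \<noteq> (0, 0) \<and> a * d = b * c) p p"
    by (rule exI[of _ "(1, 0)"]) simp
  show "symp (\<lambda>(a, b) (c, d :: complex). (a, b) \<noteq> (0, 0) \<and> (c, d) \<noteq> (0, 0) \<and> a * d = b * c)"
    by (auto intro!: sympI simp: mult.commute)
  show "transp (\<lambda>(a, b) (c, d :: complex). (a, b) \<noteq> (0, 0) \<and> (c, d) \<noteq> (0, 0) \<and> a * d = b * c)"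
  proof (rule transpI, clarsimp)
    fix a b c d e f :: complex
    assume "a = 0 \<longrightarrow> b \<noteq> 0" "c = 0 \<longrightarrow> d \<noteq> 0" "e = 0 \<longrightarrow> f \<noteq> 0"
      and *: "a * d = b * c" "c * f = d * e"
    have "c * (a * f) = c * (b * e)" "d * (a * f) = d * (b * e)"
      using * by algebra+
    then show "a * f = b * e"
      using \<open>c = 0 \<longrightarrow> d \<noteq> 0\<close> by (cases "c = 0") auto
  qed
qed

text \<open>The points \<open>[z, 1]\<close> of the open leaf and the points \<open>[1, z]\<close>; \<open>[1, 0]\<close> is the singular leaf.\<close>

lift_definition cp1_z1 :: "complex \<Rightarrow> cp1" is "\<lambda>z. (z, 1)" by simp

lift_definition cp1_1z :: "complex \<Rightarrow> cp1" is "\<lambda>z. (1, z)" by simp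


section \<open>The groupoid\<close>

text \<open>Two copies of \<open>\<complex> \<times> \<complex>\<close>, glued along \<open>z \<noteq> 0\<close>; \<open>Inl\<close> is the chart \<open>x\<close> and \<open>Inr\<close> the dotted chart.\<close>

fun glued :: "complex \<times> complex + complex \<times> complex \<Rightarrow> complex \<times> complex + complex \<times> complex \<Rightarrow> bool"
  where
    "glued (Inl p) (Inl q) \<longleftrightarrow> p = q"
  | "glued (Inr p) (Inr q) \<longleftrightarrow> p = q"
  | "glued (Inl (z, w)) (Inr q) \<longleftrightarrow> z \<noteq> 0 \<and> q = (1 / z, z\<^sup>2 / of_real ((cmod z)\<^sup>2) * w)"
  | "glued (Inr q) (Inl (z, w)) \<longleftrightarrow> z \<noteq> 0 \<and> q = (1 / z, z\<^sup>2 / of_real ((cmod z)\<^sup>2) * w)"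

quotient_type arrow = "complex \<times> complex + complex \<times> complex" / glued
proof (rule equivpI)
  show "reflp glued"
    by (rule reflpI) (metis glued.simps(1,2) sumE)
  show "symp glued"
    by (rule sympI) (elim glued.elims; auto)
  show "transp glued"
    by (rule transpI) (elim glued.elims; auto)
qed

lift_definition chart_x :: "complex \<Rightarrow> complex \<Rightarrow> arrow" is "\<lambda>z w. Inl (z, w)" .

lift_definition chart_xdot :: "complex \<Rightarrow> complex \<Rightarrow> arrow" is "\<lambda>z w. Inr (z, w)" .

lemma chart_transition:
  "z \<noteq> 0 \<Longrightarrow> chart_x z w = chart_xdot (1 / z) (z\<^sup>2 / of_real ((cmod z)\<^sup>2) * w)"
  by transfer simp

lemma chart_x_eq_iff [simp]: "chart_x z w = chart_x z' w' \<longleftrightarrow> z = z' \<and> w = w'"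
  by transfer simp

lemma chart_xdot_eq_iff [simp]: "chart_xdot z w = chart_xdot z' w' \<longleftrightarrow> z = z' \<and> w = w'"
  by transfer simp

lemma chart_x_neq_xdot_0 [simp]:
  "chart_x z w \<noteq> chart_xdot 0 w'" "chart_xdot 0 w' \<noteq> chart_x z w"
  by (transfer, simp)+

lemma arrow_cases:
  obtains (open_leaf) z w where "a = chart_x z w" | (singular_leaf) w where "a = chart_xdot 0 w"
proof -
  have "(\<exists>z w. a = chart_x z w) \<or> (\<exists>w. a = chart_xdot 0 w)"
  proof (transfer, goal_cases)
    case (1 a)
    show ?case
    proof (cases a)
      case (Inr p)
      obtain z w where p: "p = (z, w)" by (cases p)
      show ?thesis
      proof (cases "z = 0")
        case False
        then have "glued a (Inl (1 / z, of_real ((cmod (1 / z))\<^sup>2) / (1 / z)\<^sup>2 * w))"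
          using Inr p by simp
        then show ?thesis by blast
      qed (use Inr p in auto)
    qed auto
  qed
  then show thesis using that by blast
qed

lift_definition source :: "arrow \<Rightarrow> cp1" is
  "case_sum (\<lambda>(z, w). (z, 1)) (\<lambda>(z, w). (1, z))"
  by (elim glued.elims; auto)

text \<open>In the dotted chart, \<open>z + cnj w = (1 + cnj z' * cnj w') / z'\<close> for \<open>z' \<noteq> 0\<close>, and the formula
  below extends this to \<open>z' = 0\<close>, where it gives \<open>[1, 0]\<close>.\<close>

lift_definition target :: "arrow \<Rightarrow> cp1" is
  "case_sum (\<lambda>(z, w). (z + cnj w, 1)) (\<lambda>(z, w). (1 + cnj z * cnj w, z))"
proof -
  have [simp]: "1 + cnj (1 / z) * cnj (z\<^sup>2 * w / (of_real (cmod z))\<^sup>2) = (z + cnj w) / z"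
    if "z \<noteq> 0" for z w :: complex
  proof -
    have "(of_real (cmod z))\<^sup>2 = z * cnj z"
      using complex_norm_square[of z] by simp
    then have eq: "z\<^sup>2 * w / (of_real (cmod z))\<^sup>2 = z * w / cnj z"
      using that by (simp add: power2_eq_square)
    show ?thesis
      unfolding eq using that by (simp add: field_simps)
  qed
  show "?thesis p q" if "glued p q" for p q
    using that by (elim glued.elims) (auto simp del: complex_cnj_divide complex_cnj_mult)
qed

lift_definition unit_at :: "cp1 \<Rightarrow> arrow" is
  "\<lambda>(a, b). if b \<noteq> 0 then Inl (a / b, 0) else Inr (0, 0)"
  by (auto simp: field_simps)

lemma source_simps [simp]:
  "source (chart_x z w) = cp1_z1 z" "source (chart_xdot z w) = cp1_1z z"
  by (transfer, simp)+

lemma target_simps [simp]: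
  "target (chart_x z w) = cp1_z1 (z + cnj w)" "target (chart_xdot 0 w) = cp1_1z 0"
  by (transfer, simp)+

lemma unit_at_simps [simp]:
  "unit_at (cp1_z1 z) = chart_x z 0" "unit_at (cp1_1z 0) = chart_xdot 0 0"
  by (transfer, simp)+

text \<open>The product is only meaningful for composable pairs, \<open>source a = target b\<close>; on all other
  pairs it is an unspecified arrow.\<close>

definition arrow_mult :: "arrow \<Rightarrow> arrow \<Rightarrow> arrow"  (infixl "\<odot>" 70)
  where "a \<odot> b = (THE c.
    (\<exists>z w w1. a = chart_x (z + cnj w) w1 \<and> b = chart_x z w \<and> c = chart_x z (w + w1)) \<or>
    (\<exists>w1 w2. a = chart_xdot 0 w1 \<and> b = chart_xdot 0 w2 \<and> c = chart_xdot 0 (w1 + w2)))"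

definition arrow_inv :: "arrow \<Rightarrow> arrow"
  where "arrow_inv a = (THE c.
    (\<exists>z w. a = chart_x z w \<and> c = chart_x (z + cnj w) (- w)) \<or>
    (\<exists>w. a = chart_xdot 0 w \<and> c = chart_xdot 0 (- w)))"

lemma arrow_mult_simps [simp]:
  "z' = z + cnj w \<Longrightarrow> chart_x z' w1 \<odot> chart_x z w = chart_x z (w + w1)"
  "chart_xdot 0 w1 \<odot> chart_xdot 0 w2 = chart_xdot 0 (w1 + w2)"
  by (auto simp: arrow_mult_def)

lemma arrow_inv_simps [simp]:
  "arrow_inv (chart_x z w) = chart_x (z + cnj w) (- w)"
  "arrow_inv (chart_xdot 0 w) = chart_xdot 0 (- w)"
  by (auto simp: arrow_inv_def)

lemma cp1_eq_simps [simp]: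
  "cp1_z1 z = cp1_z1 z' \<longleftrightarrow> z = z'" "cp1_z1 z \<noteq> cp1_1z 0" "cp1_1z 0 \<noteq> cp1_z1 z"
  by (transfer, simp)+

lemma groupoid_laws:
  "source a = target b \<Longrightarrow> source (a \<odot> b) = source b"
  "source a = target b \<Longrightarrow> target (a \<odot> b) = target a"
  "source a = target b \<Longrightarrow> source b = target c \<Longrightarrow> (a \<odot> b) \<odot> c = a \<odot> (b \<odot> c)"
  "a \<odot> unit_at (source a) = a" "unit_at (target a) \<odot> a = a"
  "source (arrow_inv a) = target a" "target (arrow_inv a) = source a"
  "arrow_inv a \<odot> a = unit_at (source a)" "a \<odot> arrow_inv a = unit_at (target a)"
  by (cases a rule: arrow_cases; cases b rule: arrow_cases; cases c rule: arrow_cases;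
      simp add: algebra_simps)+


section \<open>Smooth and compactly supported functions\<close>

text \<open>The gluing topology, i.e. the final topology for the two charts, whose ranges are thereby open.\<close>

instantiation arrow :: topological_space
begin

definition open_arrow :: "arrow set \<Rightarrow> bool"
  where "open_arrow U \<longleftrightarrow>
    open (case_prod chart_x -` U) \<and> open (case_prod chart_xdot -` U)"

instance
  by standard (auto simp: open_arrow_def vimage_Union)

end

text \<open>\<open>C_k k f\<close>: all iterated directional derivatives of \<open>f\<close> of order at most \<open>k\<close> exist as
  values of total derivatives and are continuous.\<close>

primrec C_k :: "nat \<Rightarrow> ('a::euclidean_space \<Rightarrow> 'b::real_normed_vector) \<Rightarrow> bool"
  where
    "C_k 0 f \<longleftrightarrow> continuous_on UNIV f"
  | "C_k (Suc k) f \<longleftrightarrow>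
      f differentiable_on UNIV \<and> (\<forall>v. C_k k (\<lambda>x. frechet_derivative f (at x) v))"

definition smooth :: "('a::euclidean_space \<Rightarrow> 'b::real_normed_vector) \<Rightarrow> bool"
  where "smooth f \<longleftrightarrow> (\<forall>k. C_k k f)"

definition smooth_arrow :: "(arrow \<Rightarrow> complex) \<Rightarrow> bool"
  where "smooth_arrow f \<longleftrightarrow>
    smooth (\<lambda>(z, w). f (chart_x z w)) \<and> smooth (\<lambda>(z, w). f (chart_xdot z w))"

definition compactly_supported :: "('a::topological_space \<Rightarrow> 'b::zero) \<Rightarrow> bool"
  where "compactly_supported f \<longleftrightarrow> compact (closure {a. f a \<noteq> 0})"


section \<open>Convolution\<close>

text \<open>The \<open>s\<close>-fibre over \<open>[z, 1]\<close> is \<open>{x(z, w). w \<in> \<complex>}\<close>, carrying \<open>|dw|\<^sup>2\<close>; over \<open>[1, 0]\<close> only the dotted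
  chart is available. For \<open>z \<noteq> 0\<close> the fibre coordinates of the two charts differ by a rotation.\<close>

lift_definition fiber_measure :: "cp1 \<Rightarrow> arrow measure" is
  "\<lambda>(a, b). if b \<noteq> 0 then embed_measure lborel (chart_x (a / b))
            else embed_measure lborel (chart_xdot 0)"
  by (auto simp: frac_eq_eq mult.commute split: if_splits
      intro!: arg_cong[where f = "\<lambda>z. embed_measure lborel (chart_x z)"])

lemma fiber_measure_simps [simp]:
  "fiber_measure (cp1_z1 z) = embed_measure lborel (chart_x z)"
  "fiber_measure (cp1_1z 0) = embed_measure lborel (chart_xdot 0)"
  by (simp_all add: cp1_z1_def cp1_1z_def fiber_measure.abs_eq)

definition convolution :: "(arrow \<Rightarrow> complex) \<Rightarrow> (arrow \<Rightarrow> complex) \<Rightarrow> arrow \<Rightarrow> complex"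
  (infixl "\<star>" 70)
  where "(f \<star> g) a = (LINT b|fiber_measure (source a). f (a \<odot> arrow_inv b) * g b)"

lemma integral_embed_measure:
  fixes F :: "'b \<Rightarrow> complex"
  assumes "inj e"
  shows "integral\<^sup>L (embed_measure M e) F = (LINT x|M. F (e x))"
proof -
  have e: "e \<in> M \<rightarrow>\<^sub>M embed_measure M e"
    using assms by (rule measurable_embed_measure2)
  show ?thesis
  proof (cases "(\<lambda>x. F (e x)) \<in> borel_measurable M")
    case True
    then have "F \<in> borel_measurable (embed_measure M e)"
      using assms by (intro measurable_embed_measure1) auto
    then show ?thesis
      using embed_measure_eq_distr[OF assms, of M] integral_distr[OF e] by metis
  next
    case False
    then have "\<not> integrable (embed_measure M e) F" "\<not> integrable M (\<lambda>x. F (e x))"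
      using measurable_compose[OF e, of F borel] by (auto dest: borel_measurable_integrable)
    then show ?thesis by (simp add: not_integrable_integral_eq)
  qed
qed

lemma convolution_unit:
  "(f \<star> g) (unit_at (cp1_z1 z)) =
    (LINT w|lborel. f (chart_x (z + cnj w) (- w)) * g (chart_x z w))"
  "(f \<star> g) (unit_at (cp1_1z 0)) =
    (LINT w|lborel. f (chart_xdot 0 (- w)) * g (chart_xdot 0 w))"
  by (simp_all add: convolution_def integral_embed_measure inj_def)


section \<open>The renormalized integral\<close>

text \<open>The cutoff integral is over \<open>\<bar>z\<bar> \<le> r\<close> in the open leaf; \<open>c\<close> is the constant term of its expansion.\<close>

definition has_renormalized_integral :: "(cp1 \<Rightarrow> complex) \<Rightarrow> complex \<Rightarrow> bool"
  (infixr "has'_renormalized'_integral" 46)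
  where "h has_renormalized_integral c \<longleftrightarrow>
    (\<forall>r. set_integrable lborel (cball 0 r) (\<lambda>z. h (cp1_z1 z))) \<and>
    (\<exists>C2 C1 R. (\<lambda>r::real. (LINT z:cball 0 r|lborel. h (cp1_z1 z))
        - (C2 * of_real (r\<^sup>2) + C1 * of_real r + R * of_real (ln r) + c))
      \<in> O(\<lambda>r. of_real (1 / r)))"

lemma has_renormalized_integral_unique:
  assumes "h has_renormalized_integral c" "h has_renormalized_integral c'"
  shows "c = c'"
proof -
  let ?P = "\<lambda>C2 C1 R c r. C2 * of_real (r\<^sup>2) + C1 * of_real r + R * of_real (ln r) + (c::complex)"
  obtain C2 C1 R where 1: "(\<lambda>r. (LINT z:cball 0 r|lborel. h (cp1_z1 z)) - ?P C2 C1 R c r)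
      \<in> O(\<lambda>r. of_real (1 / r))"
    using assms(1) unfolding has_renormalized_integral_def by blast
  obtain C2' C1' R' where 2: "(\<lambda>r. (LINT z:cball 0 r|lborel. h (cp1_z1 z)) - ?P C2' C1' R' c' r)
      \<in> O(\<lambda>r. of_real (1 / r))"
    using assms(2) unfolding has_renormalized_integral_def by blast
  define a b d e where "a = C2' - C2" "b = C1' - C1" "d = R' - R" "e = c' - c"
  define p where "p = (\<lambda>r. a * of_real (r\<^sup>2) + b * of_real r + d * of_real (ln r) + e)"
  have lim: "((\<lambda>r. complex_of_real (1 / r)) \<longlongrightarrow> 0) at_top"
  proof -
    have "((\<lambda>r::real. 1 / r) \<longlongrightarrow> 0) at_top" by real_asymp
    from tendsto_of_real[OF this, where 'a = complex] show ?thesis by (simp only: of_real_0)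
  qed
  have "p \<in> O(\<lambda>r. of_real (1 / r))"
    using sum_in_bigo(2)[OF 1 2] by (simp add: p_def a_b_d_e_def algebra_simps)
  moreover have "(\<lambda>r. complex_of_real (1 / r)) \<in> o(\<lambda>_. 1)"
    using lim by (intro smalloI_tendsto) auto
  ultimately have "p \<in> o(\<lambda>_. 1)" by (rule landau_o.big_small_trans)
  then have p: "(p \<longlongrightarrow> 0) at_top" using smalloD_tendsto by fastforce
  have aux: "((\<lambda>r. p r * of_real (q r)) \<longlongrightarrow> 0) at_top" if "(q \<longlongrightarrow> 0) at_top" for q :: "real \<Rightarrow> real"
    using tendsto_mult[OF p tendsto_of_real[OF that]] by simp
  have inv: "((\<lambda>r::real. 1 / r\<^sup>2) \<longlongrightarrow> 0) at_top" "((\<lambda>r::real. 1 / r) \<longlongrightarrow> 0) at_top"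
    "((\<lambda>r::real. 1 / ln r) \<longlongrightarrow> 0) at_top" "((\<lambda>r::real. ln r / r\<^sup>2) \<longlongrightarrow> 0) at_top"
    "((\<lambda>r::real. ln r / r) \<longlongrightarrow> 0) at_top"
    by real_asymp+
  have lims: "((\<lambda>r. x * complex_of_real (q r)) \<longlongrightarrow> 0) at_top" if "(q \<longlongrightarrow> 0) at_top" for q x
    using tendsto_mult[OF tendsto_const tendsto_of_real[OF that]] by simp
  have const0: "x = 0" if "(q \<longlongrightarrow> l) at_top" "\<forall>\<^sub>F r in at_top. q r = x" "l = 0"
    for q :: "real \<Rightarrow> complex" and x l
    using tendsto_cong[THEN iffD1, OF that(2,1)] that(3) by (simp add: tendsto_const_iff)
  have "((\<lambda>r. p r * of_real (1 / r\<^sup>2) - b * of_real (1 / r) - d * of_real (ln r / r\<^sup>2) - e * of_real (1 / r\<^sup>2)) \<longlongrightarrow> 0 - 0 - 0 - 0) at_top"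
    by (intro tendsto_diff aux lims inv)
  moreover have "\<forall>\<^sub>F r in at_top. p r * of_real (1 / r\<^sup>2) - b * of_real (1 / r) - d * of_real (ln r / r\<^sup>2) - e * of_real (1 / r\<^sup>2) = a"
    using eventually_gt_at_top[of 0] by eventually_elim (simp add: p_def field_simps power2_eq_square)
  ultimately have a: "a = 0"
    by (rule const0) simp
  have "((\<lambda>r. p r * of_real (1 / r) - d * of_real (ln r / r) - e * of_real (1 / r)) \<longlongrightarrow> 0 - 0 - 0) at_top"
    by (intro tendsto_diff aux lims inv)
  moreover have "\<forall>\<^sub>F r in at_top. p r * of_real (1 / r) - d * of_real (ln r / r) - e * of_real (1 / r) = b"
    using eventually_gt_at_top[of 0] by eventually_elim (simp add: a p_def field_simps power2_eq_square)
  ultimately have b: "b = 0"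
    by (rule const0) simp
  have "((\<lambda>r. p r * of_real (1 / ln r) - e * of_real (1 / ln r)) \<longlongrightarrow> 0 - 0) at_top"
    by (intro tendsto_diff aux lims inv)
  moreover have "\<forall>\<^sub>F r in at_top. p r * of_real (1 / ln r) - e * of_real (1 / ln r) = d"
    using eventually_gt_at_top[of 1] by eventually_elim (simp add: a b p_def field_simps)
  ultimately have d: "d = 0"
    by (rule const0) simp
  have "p = (\<lambda>_. e)" by (simp add: p_def a b d)
  then have "e = 0" using p by (simp add: tendsto_const_iff)
  then show ?thesis by (simp add: a_b_d_e_def)
qed


section \<open>Real partial derivatives on the complex plane\<close>

definition partial_x :: "(complex \<Rightarrow> complex) \<Rightarrow> complex \<Rightarrow> complex"
  where "partial_x \<phi> \<zeta> = vector_derivative (\<lambda>t. \<phi> (\<zeta> + of_real t)) (at 0)"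

definition partial_y :: "(complex \<Rightarrow> complex) \<Rightarrow> complex \<Rightarrow> complex"
  where "partial_y \<phi> \<zeta> = vector_derivative (\<lambda>t. \<phi> (\<zeta> + \<i> * of_real t)) (at 0)"

end

theory Submission
  imports Defs
begin

text \<open>With \<open>k z w = f(x(z + cnj w, -w)) * g(x(z, w))\<close>, the substitution \<open>(z, w) \<mapsto> (z + cnj w, -w)\<close> turns
  the cutoff integral of the commutator into the integral of \<open>k\<close> against
  \<open>1(\<bar>z\<bar> \<le> r) - 1(\<bar>z + cnj w\<bar> \<le> r)\<close>, which is supported near the circle \<open>\<bar>z\<bar> = r\<close> because \<open>w\<close> is bounded
  on the support of \<open>g\<close>. Rotating the fibre by \<open>w = (cnj z / z) * p\<close> passes to the dotted chart and
  replaces the weight by \<open>1(\<bar>z\<bar> \<le> r) - 1(\<bar>z + p\<bar> \<le> r)\<close>. There \<open>k\<close> has an expansion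
  \<open>\<Phi> p + L p (1 / z) + O(1 / \<bar>z\<bar>\<^sup>2)\<close> with \<open>L p\<close> real linear. By translation invariance the weight has
  integral \<open>0\<close>, and its integral against \<open>cnj z / r\<^sup>2\<close>, which is close to \<open>1 / z\<close>, is \<open>\<pi> * cnj p\<close>. So the limit is
  \<open>\<pi>\<close> times the integral of \<open>L p (cnj p)\<close>, and \<open>p = - cnj w'\<close> gives the formula.\<close>


section \<open>Invariance of Lebesgue measure\<close>

lemma nn_integral_lborel_plus:
  fixes c :: "'a::euclidean_space"
  assumes [measurable]: "g \<in> borel_measurable borel"
  shows "(\<integral>\<^sup>+x. g (x + c) \<partial>lborel) = (\<integral>\<^sup>+x. g x \<partial>lborel)"
proof -
  have "(\<integral>\<^sup>+x. g x \<partial>lborel) = (\<integral>\<^sup>+x. g x \<partial>distr lborel borel ((+) c))"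
    by (simp add: lborel_distr_plus)
  also have "\<dots> = (\<integral>\<^sup>+x. g (x + c) \<partial>lborel)"
    by (subst nn_integral_distr) (auto simp: add.commute)
  finally show ?thesis ..
qed

text \<open>The standard argument for uniqueness of Haar measure: the push-forward of Lebesgue measure is
  translation invariant and agrees with Lebesgue measure on the unit ball.\<close>

lemma lborel_distr_orthogonal_transformation:
  fixes f :: "'a::euclidean_space \<Rightarrow> 'a"
  assumes f: "orthogonal_transformation f"
  shows "distr lborel borel f = lborel"
proof (rule measure_eqI)
  have lin: "linear f" and nf: "\<And>x. norm (f x) = norm x"
    using f by (auto simp: orthogonal_transformation)
  have [measurable]: "f \<in> borel_measurable borel"
    by (intro borel_measurable_continuous_onI linear_continuous_on linear_conv_bounded_linear[THEN iffD1] lin)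
  define B where "B = cball (0::'a) 1"
  have [measurable]: "B \<in> sets borel" by (simp add: B_def)
  \<comment> \<open>Finite and nonzero, so that this factor can be cancelled at the end.\<close>
  have B: "emeasure lborel B \<noteq> 0" "emeasure lborel B \<noteq> \<infinity>"
    using emeasure_lborel_cball_finite[of "0::'a" 1]
    using less_imp_neq[OF unit_ball_vol_pos[of "real DIM('a)"]] by (auto simp: B_def emeasure_cball)
  fix A :: "'a set" assume "A \<in> sets (distr lborel borel f)"
  then have [measurable]: "A \<in> sets borel" by simp
  have ff: "f y \<in> B \<longleftrightarrow> y \<in> B" for y by (simp add: B_def nf)
  \<comment> \<open>Evaluating this double integral in both orders compares \<open>A\<close> with
    its preimage under \<open>f\<close>. Integrating over \<open>x\<close> first uses only that
    \<open>A\<close> may be translated and that \<open>f\<close> preserves the ball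
    \<open>B\<close>.\<close>
  have "emeasure lborel A * emeasure lborel B =
    (\<integral>\<^sup>+y. \<integral>\<^sup>+x. indicator A (x + f y) * indicator B (f y) \<partial>lborel \<partial>lborel)"
  proof -
    have "(\<integral>\<^sup>+x. indicator A (x + c) * k \<partial>lborel) = emeasure lborel A * k" for c and k :: ennreal
      by (subst nn_integral_multc) (simp_all add: nn_integral_lborel_plus[where g = "indicator A"])
    moreover have "(\<integral>\<^sup>+y. indicator B (f y) \<partial>lborel) = emeasure lborel B"
      by (simp add: indicator_def ff flip: nn_integral_indicator)
    ultimately show ?thesis
      by (simp add: nn_integral_cmult)
  qed
  also have "\<dots> = (\<integral>\<^sup>+x. \<integral>\<^sup>+y. indicator A (x + f y) * indicator B (f y) \<partial>lborel \<partial>lborel)"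
    by (rule lborel_pair.Fubini'[symmetric]) measurable
  also have "\<dots> = (\<integral>\<^sup>+x. \<integral>\<^sup>+y. indicator A (f y) * indicator B (f y - x) \<partial>lborel \<partial>lborel)"
  proof (rule nn_integral_cong)
    fix x
    \<comment> \<open>By surjectivity and linearity of \<open>f\<close>, shifting \<open>f y\<close>
      by \<open>x\<close> amounts to translating \<open>y\<close> by \<open>c\<close>.\<close>
    obtain c where c: "x = f c"
      using orthogonal_transformation_surj[OF f] by (metis surjD)
    show "(\<integral>\<^sup>+y. indicator A (x + f y) * indicator B (f y) \<partial>lborel)
      = (\<integral>\<^sup>+y. indicator A (f y) * indicator B (f y - x) \<partial>lborel :: ennreal)"
      using nn_integral_lborel_plus[of "\<lambda>y. indicator A (f y) * indicator B (f y - x)" c]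
      by (simp add: c linear_add[OF lin] add.commute)
  qed
  also have "\<dots> = (\<integral>\<^sup>+y. \<integral>\<^sup>+x. indicator A (f y) * indicator B (f y - x) \<partial>lborel \<partial>lborel)"
    by (rule lborel_pair.Fubini') measurable
  also have "\<dots> = (\<integral>\<^sup>+y. indicator A (f y) * emeasure lborel B \<partial>lborel)"
  proof (rule nn_integral_cong)
    fix y
    have "(\<integral>\<^sup>+x. indicator B (f y - x) \<partial>lborel) = (\<integral>\<^sup>+x. indicator B (x + - f y) \<partial>lborel)"
      by (intro nn_integral_cong) (simp add: B_def indicator_def norm_minus_commute)
    also have "\<dots> = emeasure lborel B"
      by (subst nn_integral_lborel_plus) simp_all
    finally show "(\<integral>\<^sup>+x. indicator A (f y) * indicator B (f y - x) \<partial>lborel)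
      = indicator A (f y) * emeasure lborel B"
      by (simp add: nn_integral_cmult)
  qed
  also have "\<dots> = (\<integral>\<^sup>+y. indicator A (f y) \<partial>lborel) * emeasure lborel B"
    by (simp add: nn_integral_multc)
  also have "(\<integral>\<^sup>+y. indicator A (f y) \<partial>lborel) = emeasure (distr lborel borel f) A"
    using nn_integral_distr[of f lborel borel "indicator A"] by simp
  finally have "emeasure lborel B * emeasure lborel A = emeasure lborel B * emeasure (distr lborel borel f) A"
    by (simp only: mult.commute)
  then have "emeasure lborel A = emeasure (distr lborel borel f) A"
    unfolding ennreal_mult_cancel_left infinity_ennreal_def[symmetric] using B by blast
  then show "emeasure (distr lborel borel f) A = emeasure lborel A"
    by (rule sym)
qed simp


section \<open>Taylor estimates\<close>

text \<open>\<open>C_k\<close> controls one direction at a time; expanding \<open>v\<close> in the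
  finite basis turns such bounds into a bound for the whole linear map.\<close>

lemma norm_linear_le_sum_Basis:
  fixes T :: "'a::euclidean_space \<Rightarrow> 'b::real_normed_vector"
  assumes "linear T" and "\<And>b. b \<in> Basis \<Longrightarrow> norm (T b) \<le> c b"
  shows "norm (T v) \<le> (\<Sum>b\<in>Basis. c b) * norm v"
proof -
  have "T v = (\<Sum>b\<in>Basis. (v \<bullet> b) *\<^sub>R T b)"
    by (subst (1) euclidean_representation[of v, symmetric])
      (simp add: linear_sum[OF assms(1)] linear_cmul[OF assms(1)])
  also have "norm \<dots> \<le> (\<Sum>b\<in>Basis. norm v * c b)"
    using assms(2) by (intro sum_norm_le) (auto intro!: mult_mono Basis_le_norm)
  also have "\<dots> = (\<Sum>b\<in>Basis. c b) * norm v"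
    by (simp add: sum_distrib_left mult.commute)
  finally show ?thesis .
qed

lemma C_k_continuous_on:
  assumes "C_k k f"
  shows "continuous_on A f"
proof -
  have "continuous_on UNIV f"
    using assms by (cases k) (auto intro: differentiable_imp_continuous_on)
  then show ?thesis by (rule continuous_on_subset) simp
qed

lemma C_k_SucD: "C_k (Suc k) f \<Longrightarrow> C_k k f"
  by (induction k arbitrary: f) (auto intro: differentiable_imp_continuous_on)

lemma C_k_Suc_has_derivative:
  assumes "C_k (Suc k) f"
  shows "(f has_derivative frechet_derivative f (at x)) (at x)"
  using assms by (auto simp: differentiable_on_def frechet_derivative_works)

lemma C_k_Suc_linear:
  "C_k (Suc k) f \<Longrightarrow> linear (frechet_derivative f (at x))"
  using C_k_Suc_has_derivative has_derivative_linear by blast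

lemma C_k_Suc_directional:
  "C_k (Suc k) f \<Longrightarrow> C_k k (\<lambda>x. frechet_derivative f (at x) v)"
  by simp

text \<open>The derivative along each basis vector is continuous, hence bounded on the compact set,
  and there are finitely many basis vectors.\<close>

lemma C_1_derivative_bound:
  fixes f :: "'a::euclidean_space \<Rightarrow> 'b::real_normed_vector"
  assumes f: "C_k (Suc 0) f" and K: "compact K"
  obtains L where "\<And>x v. x \<in> K \<Longrightarrow> norm (frechet_derivative f (at x) v) \<le> L * norm v"
proof -
  let ?D = "\<lambda>x. frechet_derivative f (at x)"
  have "\<exists>c. \<forall>x\<in>K. norm (?D x b) \<le> c" for b
  proof -
    have "bounded ((\<lambda>x. ?D x b) ` K)"
      using C_k_continuous_on[OF C_k_Suc_directional[OF f]] K
      by (intro compact_imp_bounded compact_continuous_image)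
    then show ?thesis by (auto simp: bounded_iff)
  qed
  then obtain c where c: "\<And>b x. x \<in> K \<Longrightarrow> norm (?D x b) \<le> c b" by metis
  have "norm (?D x v) \<le> (\<Sum>b\<in>Basis. c b) * norm v" if "x \<in> K" for x v
    using norm_linear_le_sum_Basis[OF C_k_Suc_linear[OF f] c[OF that]] .
  then show thesis by (rule that)
qed

lemma C_1_lipschitz:
  fixes f :: "'a::euclidean_space \<Rightarrow> 'b::real_normed_vector"
  assumes f: "C_k (Suc 0) f" and K: "compact K" "convex K"
  obtains L where "\<And>x y. x \<in> K \<Longrightarrow> y \<in> K \<Longrightarrow> norm (f x - f y) \<le> L * norm (x - y)"
proof -
  obtain L where "\<And>x v. x \<in> K \<Longrightarrow> norm (frechet_derivative f (at x) v) \<le> L * norm v"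
    using C_1_derivative_bound[OF f K(1)] by blast
  then have "norm (f x - f y) \<le> L * norm (x - y)" if "x \<in> K" "y \<in> K" for x y
    using that C_k_Suc_has_derivative[OF f]
    by (intro differentiable_bound[OF K(2)]) (auto intro: onorm_le has_derivative_at_withinI)
  then show thesis by (rule that)
qed

text \<open>Each basis directional derivative is itself Lipschitz on \<open>K\<close>, so the
  derivative of \<open>f\<close> changes by at most a multiple of \<open>norm (y - x)\<close> along
  the segment. The mean value inequality for \<open>f\<close> minus its linearization then gives a
  quadratic error.\<close>

lemma C_2_taylor:
  fixes f :: "'a::euclidean_space \<Rightarrow> 'b::real_normed_vector"
  assumes f: "C_k (Suc (Suc 0)) f" and K: "compact K" "convex K"
  obtains M where "\<And>x y. x \<in> K \<Longrightarrow> y \<in> K \<Longrightarrow>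
    norm (f y - f x - frechet_derivative f (at x) (y - x)) \<le> M * (norm (y - x))\<^sup>2"
proof -
  let ?D = "\<lambda>x. frechet_derivative f (at x)"
  have "\<exists>L. \<forall>x\<in>K. \<forall>y\<in>K. norm (?D x b - ?D y b) \<le> L * norm (x - y)" for b
    using C_1_lipschitz[OF C_k_Suc_directional[OF f] K] by metis
  then obtain L where L: "\<And>b x y. x \<in> K \<Longrightarrow> y \<in> K \<Longrightarrow> norm (?D x b - ?D y b) \<le> L b * norm (x - y)"
    by metis
  have L0: "0 \<le> L b * norm (x - y)" if "x \<in> K" "y \<in> K" for b x y
    using L[OF that, of b] norm_ge_zero order_trans by blast
  let ?M = "\<Sum>b\<in>Basis. L b"
  have "norm (f y - f x - ?D x (y - x)) \<le> ?M * (norm (y - x))\<^sup>2" if xy: "x \<in> K" "y \<in> K" for x y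
  proof -
    have seg: "closed_segment x y \<subseteq> K"
      using K(2) xy by (simp add: convex_contains_segment)
    have "norm (f y - f x - ?D x (y - x)) \<le> norm (y - x) * (?M * norm (y - x))"
    proof (rule differentiable_bound_linearization[where S = "closed_segment x y"])
      show "x + t *\<^sub>R (y - x) \<in> closed_segment x y" if "t \<in> {0..1}" for t
        unfolding in_segment using that by (intro exI[of _ t]) (auto simp: algebra_simps)
      show "(f has_derivative ?D z) (at z within closed_segment x y)" for z
        using C_k_Suc_has_derivative[OF f] by (rule has_derivative_at_withinI)
      show "onorm (?D z - ?D x) \<le> ?M * norm (y - x)" if z: "z \<in> closed_segment x y" for z
      proof (rule onorm_le)
        fix v
        have "linear (?D z - ?D x)"
          unfolding fun_diff_def
          by (intro linear_compose_sub C_k_Suc_linear[OF f])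
        then have "norm ((?D z - ?D x) v) \<le> (\<Sum>b\<in>Basis. L b * norm (z - x)) * norm v"
          using L[of z x] z seg xy by (intro norm_linear_le_sum_Basis[where T = "?D z - ?D x"]) auto
        also have "(\<Sum>b\<in>Basis. L b * norm (z - x)) = ?M * norm (z - x)"
          by (simp add: sum_distrib_right)
        \<comment> \<open>The numbers \<open>L b\<close> are not assumed nonnegative. For distinct
          points \<open>L0\<close> yields the sign of \<open>?M\<close>; for equal points both sides
          vanish.\<close>
        also have "\<dots> \<le> ?M * norm (y - x)"
        proof (cases "x = y")
          case False
          have "0 \<le> ?M * norm (y - x)"
            using L0[OF xy(2,1)] by (simp add: sum_distrib_right sum_nonneg)
          with False have "0 \<le> ?M" by (simp add: zero_le_mult_iff)
          with z show ?thesis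
            by (intro mult_left_mono) (auto dest: segment_bound(1) simp: norm_minus_commute)
        qed (use z in auto)
        finally show "norm ((?D z - ?D x) v) \<le> ?M * norm (y - x) * norm v"
          by (simp add: mult_right_mono)
      qed
    qed auto
    then show ?thesis by (simp add: power2_eq_square mult_ac)
  qed
  then show thesis by (rule that)
qed


section \<open>The convolution kernel near the singular leaf\<close>

text \<open>The integrand of the convolution at a unit, seen from the singular leaf: for \<open>\<zeta> = 1 / z\<close> the arrow
  \<open>x(z, w)\<close> is \<open>xdot(\<zeta>, p)\<close> with \<open>w = (cnj z / z) * p\<close>, and the argument of \<open>F\<close> is
  its inverse in the dotted chart. This is smooth in \<open>\<zeta>\<close> up to \<open>\<zeta> = 0\<close>.\<close>

definition leaf_kernel :: "(complex \<times> complex \<Rightarrow> complex) \<Rightarrow> (complex \<times> complex \<Rightarrow> complex) \<Rightarrow> complex \<Rightarrow> complex \<Rightarrow> complex"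
  where "leaf_kernel F G \<zeta> p =
    F (\<zeta> / (1 + cnj (\<zeta> * p)), - ((1 + cnj (\<zeta> * p)) / (1 + \<zeta> * p) * p)) * G (\<zeta>, p)"

text \<open>The real derivative of \<open>leaf_kernel F G\<close> in its first argument at
  \<open>0\<close>, in direction \<open>\<zeta>\<close>. To first order the argument of
  \<open>F\<close> moves away from \<open>(0, - p)\<close> by
  \<open>(\<zeta>, (\<zeta> * p - cnj (\<zeta> * p)) * p)\<close>, and that of \<open>G\<close>
  moves by \<open>(\<zeta>, 0)\<close>.\<close>

definition leaf_linear_term :: "(complex \<times> complex \<Rightarrow> complex) \<Rightarrow> (complex \<times> complex \<Rightarrow> complex) \<Rightarrow> complex \<Rightarrow> complex \<Rightarrow> complex"
  where "leaf_linear_term F G p \<zeta> =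
    frechet_derivative F (at (0, - p)) (\<zeta>, (\<zeta> * p - cnj (\<zeta> * p)) * p) * G (0, p) +
    F (0, - p) * frechet_derivative G (at (0, p)) (\<zeta>, 0)"

text \<open>Taylor expansion at the singular leaf, uniform in \<open>p\<close>. The smallness of
  \<open>\<zeta>\<close> keeps \<open>1 + \<zeta> * p\<close> and its conjugate at distance at least
  \<open>1 / 2\<close> from \<open>0\<close>, so all arguments of \<open>F\<close> and
  \<open>G\<close> stay in a fixed ball.\<close>

lemma leaf_kernel_expansion:
  fixes F G :: "complex \<times> complex \<Rightarrow> complex"
  assumes F: "C_k (Suc (Suc 0)) F" and G: "C_k (Suc (Suc 0)) G" and B: "1 \<le> B"
  obtains M where "\<And>p \<zeta>. cmod p \<le> B \<Longrightarrow> cmod \<zeta> * B \<le> 1 / 2 \<Longrightarrow>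
    cmod (leaf_kernel F G \<zeta> p - F (0, - p) * G (0, p) - leaf_linear_term F G p \<zeta>) \<le> M * (cmod \<zeta>)\<^sup>2"
proof -
  define K where "K = cball (0 :: complex \<times> complex) (2 + B)"
  have K: "compact K" "convex K" by (auto simp: K_def)
  have inK: "(\<zeta>, q) \<in> K" if "cmod \<zeta> \<le> 2" "cmod q \<le> B" for \<zeta> q
    using that norm_Pair_le[of \<zeta> q] by (simp add: K_def)
  have bounded_on_K: "\<exists>b. \<forall>x\<in>K. cmod (H x) \<le> b" if "C_k (Suc (Suc 0)) H" for H :: "complex \<times> complex \<Rightarrow> complex"
    using compact_imp_bounded[OF compact_continuous_image[OF C_k_continuous_on[OF that] K(1)]]
    by (auto simp: bounded_iff)
  obtain bF bG where bF: "\<And>x. x \<in> K \<Longrightarrow> cmod (F x) \<le> bF" and bG: "\<And>x. x \<in> K \<Longrightarrow> cmod (G x) \<le> bG"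
    using bounded_on_K[OF F] bounded_on_K[OF G] by auto
  obtain NF where NF: "\<And>x v. x \<in> K \<Longrightarrow> cmod (frechet_derivative F (at x) v) \<le> NF * norm v"
    using C_1_derivative_bound[OF C_k_SucD[OF F] K(1)] by blast
  obtain NG where NG: "\<And>x v. x \<in> K \<Longrightarrow> cmod (frechet_derivative G (at x) v) \<le> NG * norm v"
    using C_1_derivative_bound[OF C_k_SucD[OF G] K(1)] by blast
  obtain MF where MF: "\<And>x y. x \<in> K \<Longrightarrow> y \<in> K \<Longrightarrow>
      norm (F y - F x - frechet_derivative F (at x) (y - x)) \<le> MF * (norm (y - x))\<^sup>2"
    using C_2_taylor[OF F K] by blast
  obtain MG where MG: "\<And>x y. x \<in> K \<Longrightarrow> y \<in> K \<Longrightarrow>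
      norm (G y - G x - frechet_derivative G (at x) (y - x)) \<le> MG * (norm (y - x))\<^sup>2"
    using C_2_taylor[OF G K] by blast
  \<comment> \<open>The points \<open>0\<close> and \<open>(1, 0)\<close> serve as test data: the
    estimates there show that all constants are nonnegative.\<close>
  have "0 \<in> K" using B by (simp add: K_def)
  moreover have "(1, 0) \<in> K" using B by (simp add: K_def norm_Pair)
  ultimately have nn: "0 \<le> bF" "0 \<le> bG" "0 \<le> NF" "0 \<le> NG" "0 \<le> MF" "0 \<le> MG"
    using order_trans[OF norm_ge_zero bF] order_trans[OF norm_ge_zero bG]
      order_trans[OF norm_ge_zero NF[of 0 "(1, 0)"]] order_trans[OF norm_ge_zero NG[of 0 "(1, 0)"]]
      order_trans[OF norm_ge_zero MF[of 0 "(1, 0)"]] order_trans[OF norm_ge_zero MG[of 0 "(1, 0)"]]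
    by (auto simp: norm_Pair)
  \<comment> \<open>\<open>c1\<close> bounds the displacement of the argument of \<open>F\<close>
    relative to \<open>cmod \<zeta>\<close>, \<open>c2\<close> its deviation from the first-order
    part relative to the square, and \<open>C2\<close> the resulting error in
    \<open>F\<close>.\<close>
  define c1 where "c1 = 2 + 4 * B\<^sup>2"
  define c2 where "c2 = 2 * B + 4 * B ^ 3"
  define C2 where "C2 = MF * c1\<^sup>2 + NF * c2"
  have "cmod (leaf_kernel F G \<zeta> p - F (0, - p) * G (0, p) - leaf_linear_term F G p \<zeta>)
      \<le> (NF * c1 * NG + C2 * (bG + NG) + bF * MG) * (cmod \<zeta>)\<^sup>2"
    if p: "cmod p \<le> B" and \<zeta>: "cmod \<zeta> * B \<le> 1 / 2" for p \<zeta>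
  proof -
    let ?s = "cmod \<zeta>"
    define c where "c = \<zeta> * p"
    have c: "cmod c \<le> ?s * B"
      using p by (auto simp: c_def norm_mult intro: mult_left_mono)
    have "?s * 1 \<le> ?s * B" using B by (intro mult_left_mono) auto
    then have s1: "?s \<le> 1 / 2" using \<zeta> by linarith
    have half: "1 / 2 \<le> cmod (1 + c)" "1 / 2 \<le> cmod (1 + cnj c)"
      using c \<zeta> norm_diff_ineq[of 1 c] norm_diff_ineq[of 1 "cnj c"] by auto
    then have nz: "1 + c \<noteq> 0" "1 + cnj c \<noteq> 0" by auto
    have div: "cmod (x / (1 + c)) \<le> 2 * cmod x" "cmod (x / (1 + cnj c)) \<le> 2 * cmod x" for x
    proof -
      show "cmod (x / (1 + c)) \<le> 2 * cmod x"
        using mult_left_mono[OF half(1), of "cmod x"] nz by (simp add: norm_divide field_simps)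
      show "cmod (x / (1 + cnj c)) \<le> 2 * cmod x"
        using mult_left_mono[OF half(2), of "cmod x"] nz by (simp add: norm_divide field_simps)
    qed
    define d1 where "d1 = \<zeta> / (1 + cnj c)"
    define e2 where "e2 = - ((1 + cnj c) / (1 + c) * p)"
    define d2 where "d2 = e2 + p"
    have cc: "cmod (c - cnj c) \<le> 2 * (?s * B)"
      using norm_triangle_ineq4[of c "cnj c"] c by simp
    have d1: "cmod d1 \<le> 2 * ?s" unfolding d1_def by (rule div)
    \<comment> \<open>Hence \<open>e2\<close> has the same modulus as \<open>p\<close> and the
      argument of \<open>F\<close> remains in \<open>K\<close>.\<close>
    have "cmod (1 + cnj c) = cmod (1 + c)"
      by (metis complex_cnj_add complex_cnj_one complex_mod_cnj)
    then have e2: "cmod e2 \<le> B"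
      using p nz by (simp add: e2_def norm_mult norm_divide)
    have d2_eq: "d2 = (c - cnj c) / (1 + c) * p"
      using nz by (simp add: d2_def e2_def field_simps)
    have d2: "cmod d2 \<le> 4 * B\<^sup>2 * ?s"
    proof -
      have "cmod d2 \<le> (2 * (2 * (?s * B))) * B"
        unfolding d2_eq norm_mult using cc div(1)[of "c - cnj c"] p B by (intro mult_mono) auto
      then show ?thesis by (simp add: power2_eq_square mult_ac)
    qed
    have d: "norm (d1, d2) \<le> c1 * ?s"
      using norm_Pair_le[of d1 d2] d1 d2 by (simp add: c1_def algebra_simps)
    have r1: "cmod (d1 - \<zeta>) \<le> 2 * B * ?s\<^sup>2"
    proof -
      have "d1 - \<zeta> = (- \<zeta> * cnj c) / (1 + cnj c)"
        using nz by (simp add: d1_def field_simps)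
      then have "cmod (d1 - \<zeta>) \<le> 2 * (?s * cmod c)"
        using div(2)[of "- \<zeta> * cnj c"] by (simp add: norm_mult)
      also have "\<dots> \<le> 2 * (?s * (?s * B))"
        using c by (intro mult_left_mono) auto
      finally show ?thesis by (simp add: power2_eq_square mult_ac)
    qed
    have r2: "cmod (d2 - (c - cnj c) * p) \<le> 4 * B ^ 3 * ?s\<^sup>2"
    proof -
      have "d2 - (c - cnj c) * p = (- (c - cnj c) * c) / (1 + c) * p"
        using nz by (simp add: d2_eq field_simps)
      also have "cmod \<dots> \<le> (2 * (2 * (?s * B) * (?s * B))) * B"
        unfolding norm_mult
      proof (rule mult_mono)
        have "cmod (- (c - cnj c) * c / (1 + c)) \<le> 2 * cmod (- (c - cnj c) * c)"
          by (rule div)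
        also have "\<dots> = 2 * (cmod (c - cnj c) * cmod c)" by (simp add: norm_mult norm_minus_commute)
        also have "\<dots> \<le> 2 * (2 * (?s * B) * (?s * B))"
          using cc c B by (intro mult_left_mono mult_mono) auto
        finally show "cmod (- (c - cnj c) * c / (1 + c)) \<le> 2 * (2 * (?s * B) * (?s * B))" .
      qed (use p B in auto)
      finally show ?thesis by (simp add: power2_eq_square power3_eq_cube mult_ac)
    qed
    have r: "norm (d1 - \<zeta>, d2 - (c - cnj c) * p) \<le> c2 * ?s\<^sup>2"
      using norm_Pair_le[of "d1 - \<zeta>" "d2 - (c - cnj c) * p"] r1 r2 by (simp add: c2_def algebra_simps)
    let ?DF = "frechet_derivative F (at (0, - p))" and ?DG = "frechet_derivative G (at (0, p))"
    have linF: "linear ?DF" using F by (intro C_k_Suc_linear)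
    have x0: "(0, - p) \<in> K" "(0, p) \<in> K" using p by (auto intro: inK)
    have x1: "(d1, e2) \<in> K" "(\<zeta>, p) \<in> K"
      using p e2 d1 s1 by (auto intro!: inK)
    define F1 where "F1 = ?DF (\<zeta>, (c - cnj c) * p)"
    define F2 where "F2 = F (d1, e2) - F (0, - p) - F1"
    define G1 where "G1 = ?DG (\<zeta>, 0)"
    define G2 where "G2 = G (\<zeta>, p) - G (0, p) - G1"
    have F2: "cmod F2 \<le> C2 * ?s\<^sup>2"
    proof -
      \<comment> \<open>Taylor's estimate uses the true displacement \<open>(d1, d2)\<close>;
        linearity of the derivative then replaces it by its first-order part, at quadratic
        cost.\<close>
      have "?DF (d1, d2) - F1 = ?DF (d1 - \<zeta>, d2 - (c - cnj c) * p)"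
        unfolding F1_def linear_diff[OF linF, symmetric] by simp
      then have "F2 = (F (d1, e2) - F (0, - p) - ?DF ((d1, e2) - (0, - p))) + ?DF (d1 - \<zeta>, d2 - (c - cnj c) * p)"
        by (simp add: F2_def d2_def algebra_simps)
      also have "cmod \<dots> \<le> MF * (norm ((d1, e2) - (0, - p)))\<^sup>2 + NF * norm (d1 - \<zeta>, d2 - (c - cnj c) * p)"
        by (intro norm_triangle_mono MF NF x0 x1)
      also have "\<dots> \<le> MF * (c1 * ?s)\<^sup>2 + NF * (c2 * ?s\<^sup>2)"
        using d r nn by (intro add_mono mult_left_mono power_mono) (auto simp: d2_def)
      finally show ?thesis by (simp add: C2_def power_mult_distrib algebra_simps)
    qed
    have F1: "cmod F1 \<le> NF * c1 * ?s"
    proof -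
      have "cmod ((c - cnj c) * p) \<le> 2 * (?s * B) * B"
        unfolding norm_mult using cc p B by (intro mult_mono) auto
      also have "\<dots> \<le> 4 * B\<^sup>2 * ?s" using B by (simp add: power2_eq_square mult_ac)
      finally have "norm (\<zeta>, (c - cnj c) * p) \<le> c1 * ?s"
        using norm_Pair_le[of \<zeta> "(c - cnj c) * p"] by (simp add: c1_def distrib_right)
          (smt (verit) norm_ge_zero)
      then show ?thesis
        using order_trans[OF NF[OF x0(1)] mult_left_mono[OF _ nn(3)]] by (simp add: F1_def mult.assoc)
    qed
    have G1: "cmod G1 \<le> NG * ?s"
      using NG[OF x0(2), of "(\<zeta>, 0)"] by (simp add: G1_def norm_Pair)
    have G1': "cmod G1 \<le> NG"
      using order_trans[OF G1 mult_left_mono[of ?s 1 NG]] s1 nn by simp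
    have G2: "cmod G2 \<le> MG * ?s\<^sup>2"
      using MG[OF x0(2) x1(2)] by (simp add: G2_def G1_def norm_Pair)
    have "leaf_kernel F G \<zeta> p = F (d1, e2) * G (\<zeta>, p)"
      by (simp only: leaf_kernel_def c_def d1_def e2_def)
    moreover have "leaf_linear_term F G p \<zeta> = F1 * G (0, p) + F (0, - p) * G1"
      by (simp only: leaf_linear_term_def F1_def G1_def c_def)
    \<comment> \<open>With both factors split into value, linear part and remainder, only the
      product of the two linear parts and the terms containing a remainder survive.\<close>
    ultimately have "leaf_kernel F G \<zeta> p - F (0, - p) * G (0, p) - leaf_linear_term F G p \<zeta>
        = F1 * G1 + F2 * (G (0, p) + G1) + F (d1, e2) * G2"
      by (simp add: F2_def G2_def algebra_simps)
    also have "cmod \<dots> \<le> (NF * c1 * ?s) * (NG * ?s) + (C2 * ?s\<^sup>2) * (bG + NG) + bF * (MG * ?s\<^sup>2)"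
      using order_trans[OF norm_ge_zero F1] order_trans[OF norm_ge_zero F2]
      by (intro norm_triangle_mono order_trans[OF norm_mult_ineq] mult_mono F1 G1 F2 bF G2 x1
          order_trans[OF norm_triangle_ineq] add_mono bG x0 G1' nn norm_ge_zero add_nonneg_nonneg)
        auto
    finally show ?thesis by (simp add: power2_eq_square algebra_simps)
  qed
  then show thesis by (rule that)
qed


section \<open>Differences of translated discs\<close>

lemma lborel_integral_plus:
  fixes c :: "'a::euclidean_space" and h :: "'a \<Rightarrow> 'b::{banach, second_countable_topology}"
  assumes [measurable]: "h \<in> borel_measurable borel"
  shows "(LINT x|lborel. h (x + c)) = (LINT x|lborel. h x)"
proof -
  have "(LINT x|lborel. h x) = (LINT x|distr lborel borel ((+) c). h x)"
    by (simp add: lborel_distr_plus)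
  also have "\<dots> = (LINT x|lborel. h (x + c))"
    by (subst integral_distr) (auto simp: add.commute)
  finally show ?thesis ..
qed

lemma lborel_integrable_plus:
  fixes c :: "'a::euclidean_space" and h :: "'a \<Rightarrow> 'b::{banach, second_countable_topology}"
  assumes "integrable lborel h"
  shows "integrable lborel (\<lambda>x. h (x + c))"
proof -
  have [measurable]: "h \<in> borel_measurable borel"
    using borel_measurable_integrable[OF assms] by simp
  have "integrable (distr lborel borel ((+) c)) h"
    using assms by (simp add: lborel_distr_plus)
  then show ?thesis
    by (subst (asm) integrable_distr_eq) (auto simp: add.commute)
qed

lemma integrable_lborel_bounded_support:
  fixes h :: "'a::euclidean_space \<Rightarrow> 'b::{banach, second_countable_topology}"
  assumes h: "h \<in> borel_measurable borel"
    and R: "\<And>x. norm (h x) \<le> C" "\<And>x. R < norm x \<Longrightarrow> h x = 0"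
  shows "integrable lborel h"
proof (rule Bochner_Integration.integrable_bound)
  show "integrable lborel (\<lambda>x. indicator (cball (0::'a) R) x * C :: real)"
    using emeasure_lborel_cball_finite[of "0::'a" R] by simp
  show "AE x in lborel. norm (h x) \<le> norm (indicator (cball (0::'a) R) x * C :: real)"
    using R norm_ge_zero[THEN order_trans, OF R(1)] by (auto simp: indicator_def not_le)
qed (use h in simp)

definition disc_diff :: "real \<Rightarrow> complex \<Rightarrow> complex \<Rightarrow> real"
  where "disc_diff r z p = indicator (cball 0 r) z - indicator (cball 0 r) (z + p)"

lemma disc_diff_measurable [measurable]:
  "(\<lambda>x. disc_diff r (fst x) (snd x)) \<in> borel_measurable borel"
  "(\<lambda>z. disc_diff r z p) \<in> borel_measurable borel"
proof -
  have I: "indicat_real (cball (0::complex) r) \<in> borel_measurable borel"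
    by (rule borel_measurable_indicator) simp
  have *: "(\<lambda>x. indicat_real (cball 0 r) (T x)) \<in> borel_measurable borel"
    if "continuous_on UNIV T" for T :: "'a::topological_space \<Rightarrow> complex"
    using measurable_compose[OF borel_measurable_continuous_onI[OF that] I] .
  then show "(\<lambda>x. disc_diff r (fst x) (snd x)) \<in> borel_measurable borel"
    "(\<lambda>z. disc_diff r z p) \<in> borel_measurable borel"
    unfolding disc_diff_def by (intro borel_measurable_diff * continuous_intros)+
qed

lemma abs_disc_diff_le: "\<bar>disc_diff r z p\<bar> \<le> 1"
  by (auto simp: disc_diff_def indicator_def)

text \<open>The two discs differ only within distance \<open>B\<close> of the circle of radius
  \<open>r\<close>, hence on an annulus whose area grows linearly in \<open>r\<close>.\<close>

lemma disc_diff_eq_0: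
  assumes "cmod p \<le> B" and "cmod z \<notin> {r - B..r + B}"
  shows "disc_diff r z p = 0"
  using assms norm_triangle_ineq[of z p] norm_triangle_ineq4[of "z + p" p] norm_ge_zero[of p]
  by (auto simp: disc_diff_def indicator_def)

lemma content_cball_complex:
  "0 \<le> r \<Longrightarrow> measure lborel (cball (c::complex) r) = pi * r\<^sup>2"
  by (simp add: content_cball unit_ball_vol_2)

text \<open>A disc and its translate have equal area. This removes the constant term of the kernel
  expansion.\<close>

lemma integral_disc_diff:
  "(LINT z|lborel. disc_diff r z p) = 0"
proof -
  have i: "integrable lborel (indicat_real (cball (0::complex) r))"
    using emeasure_lborel_cball_finite[of "0::complex" r] by simp
  show ?thesis
    unfolding disc_diff_def
    by (subst Bochner_Integration.integral_diff[OF i lborel_integrable_plus[OF i]])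
      (simp add: lborel_integral_plus[OF borel_measurable_integrable[OF i, simplified]])
qed

text \<open>Moving the second disc back to the origin replaces \<open>l z\<close> by
  \<open>l (z - p)\<close> there, so the difference is the constant \<open>l p\<close> on a disc of
  area \<open>pi * r\<^sup>2\<close>.\<close>

lemma integral_disc_diff_linear:
  fixes l :: "complex \<Rightarrow> complex"
  assumes l: "linear l" and r: "0 \<le> r"
  shows "(LINT z|lborel. disc_diff r z p *\<^sub>R l z) = (pi * r\<^sup>2) *\<^sub>R l p"
proof -
  let ?I = "indicat_real (cball (0::complex) r)"
  have l_meas: "l \<in> borel_measurable borel"
    using l by (intro borel_measurable_continuous_onI linear_continuous_on) (simp add: linear_conv_bounded_linear)
  have i: "integrable lborel ?I"
    using emeasure_lborel_cball_finite[of "0::complex" r] by simp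
  obtain K where K: "\<And>x. norm (l x) \<le> K * norm x"
    using linear_bounded[OF l] by blast
  have K0: "0 \<le> K" using order_trans[OF norm_ge_zero K[of 1]] by simp
  have meas: "(\<lambda>z. ?I z *\<^sub>R l (z - q)) \<in> borel_measurable borel" for q
    using borel_measurable_integrable[OF i] measurable_compose[OF _ l_meas, of "\<lambda>z. z - q" borel]
    by (intro borel_measurable_scaleR) simp_all
  have il: "integrable lborel (\<lambda>z. ?I z *\<^sub>R l (z - q))" for q
  proof (rule integrable_lborel_bounded_support[where R = r])
    show "norm (?I z *\<^sub>R l (z - q)) \<le> K * (r + norm q)" for z
    proof (cases "cmod z \<le> r")
      case True
      then have "K * cmod (z - q) \<le> K * (r + norm q)"
        using K0 norm_triangle_ineq4[of z q] by (intro mult_left_mono) auto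
      then show ?thesis using True K[of "z - q"] by simp
    qed (use K0 r in \<open>auto simp: indicator_def\<close>)
  qed (use meas in \<open>auto simp: indicator_def\<close>)
  have "disc_diff r z p *\<^sub>R l z = ?I z *\<^sub>R l (z - 0) - ?I (z + p) *\<^sub>R l ((z + p) - p)" for z
    by (simp add: disc_diff_def scaleR_diff_left)
  then have "(LINT z|lborel. disc_diff r z p *\<^sub>R l z) =
      (LINT z|lborel. ?I z *\<^sub>R l (z - 0)) - (LINT z|lborel. ?I (z + p) *\<^sub>R l ((z + p) - p))"
    using Bochner_Integration.integral_diff[OF il[of 0] lborel_integrable_plus[OF il[of p], of p]]
    by simp
  also have "(LINT z|lborel. ?I (z + p) *\<^sub>R l ((z + p) - p)) = (LINT z|lborel. ?I z *\<^sub>R l (z - p))"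
    by (rule lborel_integral_plus[OF meas])
  also have "(LINT z|lborel. ?I z *\<^sub>R l (z - 0)) - (LINT z|lborel. ?I z *\<^sub>R l (z - p))
      = (LINT z|lborel. ?I z *\<^sub>R l p)"
    by (subst Bochner_Integration.integral_diff[OF il il, symmetric])
      (simp add: linear_diff[OF l] algebra_simps)
  also have "\<dots> = (pi * r\<^sup>2) *\<^sub>R l p"
    using i r by (simp add: content_cball_complex)
  finally show ?thesis .
qed

text \<open>On the support of \<open>disc_diff\<close> one may replace \<open>1 / z = cnj z / \<bar>z\<bar>\<^sup>2\<close> by \<open>cnj z / r\<^sup>2\<close>: the error is
  \<open>O(1 / r\<^sup>2)\<close>, on a region of area \<open>O(r)\<close>. The resulting integrals over \<open>z\<close> are exact.\<close>

lemma disc_diff_asymptotics: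
  fixes N :: "complex \<Rightarrow> complex \<Rightarrow> complex" and \<Phi> :: "complex \<Rightarrow> complex" and L :: "complex \<Rightarrow> complex \<Rightarrow> complex"
  assumes B: "1 \<le> B"
    and N: "(\<lambda>x. N (fst x) (snd x)) \<in> borel_measurable borel"
      "\<And>R. \<exists>C. \<forall>z p. cmod z \<le> R \<longrightarrow> cmod (N z p) \<le> C"
    and \<Phi>: "continuous_on UNIV \<Phi>"
    and L: "continuous_on UNIV (\<lambda>x. L (fst x) (snd x))" "\<And>p. linear (L p)"
    and supp: "\<And>z p. B < cmod p \<Longrightarrow> N z p = 0" "\<And>p. B < cmod p \<Longrightarrow> \<Phi> p = 0" "\<And>p \<zeta>. B < cmod p \<Longrightarrow> L p \<zeta> = 0"
    and est: "\<And>z p. cmod p \<le> B \<Longrightarrow> 2 * B \<le> cmod z \<Longrightarrow>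
      cmod (N z p - \<Phi> p - L p (1 / z)) \<le> M / (cmod z)\<^sup>2"
  shows "(\<lambda>r. (LINT x|lborel. disc_diff r (fst x) (snd x) *\<^sub>R N (fst x) (snd x)) - pi *\<^sub>R (LINT p|lborel. L p (cnj p)))
    \<in> O(\<lambda>r. of_real (1 / r))"
proof -
  have LL: "(\<lambda>x. L (snd x) (cnj (fst x))) \<in> borel_measurable borel"
    by (intro borel_measurable_continuous_onI continuous_on_compose2[OF L(1), of _ "\<lambda>x. (snd x, cnj (fst x))", simplified] continuous_intros)
  have \<Phi>': "(\<lambda>x::complex \<times> complex. \<Phi> (snd x)) \<in> borel_measurable borel"
    by (intro borel_measurable_continuous_onI continuous_on_compose2[OF \<Phi>] continuous_intros) simp
  have "\<exists>b. \<forall>x \<in> cball 0 B \<times> cball 0 1. cmod (L (fst x) (snd x)) \<le> b"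
    using compact_imp_bounded[OF compact_continuous_image[OF continuous_on_subset[OF L(1)] compact_Times[OF compact_cball compact_cball]]]
    by (auto simp: bounded_iff)
  then obtain C where "\<And>p \<zeta>. cmod p \<le> B \<Longrightarrow> cmod \<zeta> \<le> 1 \<Longrightarrow> cmod (L p \<zeta>) \<le> C"
    by force
  then have C1: "cmod (L p \<zeta>) \<le> \<bar>C\<bar>" if "cmod \<zeta> \<le> 1" for p \<zeta>
    using supp(3)[of p \<zeta>] that by (cases "cmod p \<le> B") (auto intro: order_trans[OF _ abs_ge_self])
  have C: "cmod (L p \<zeta>) \<le> \<bar>C\<bar> * cmod \<zeta>" for p \<zeta>
  proof (cases "\<zeta> = 0")
    case False
    \<comment> \<open>Homogeneity spreads the bound from the unit circle to all
      \<open>\<zeta>\<close>.\<close>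
    have "cmod (L p \<zeta>) = cmod \<zeta> * cmod (L p (\<zeta> /\<^sub>R cmod \<zeta>))"
      using False by (simp add: linear_cmul[OF L(2)])
    also have "\<dots> \<le> cmod \<zeta> * \<bar>C\<bar>"
      using False by (intro mult_left_mono C1) auto
    finally show ?thesis by (simp add: mult.commute)
  qed (simp add: linear_0[OF L(2)])
  have "\<exists>b. \<forall>p \<in> cball 0 B. cmod (\<Phi> p) \<le> b"
    using compact_imp_bounded[OF compact_continuous_image[OF continuous_on_subset[OF \<Phi>] compact_cball]]
    by (auto simp: bounded_iff)
  then obtain b where "\<And>p. cmod p \<le> B \<Longrightarrow> cmod (\<Phi> p) \<le> b"
    by force
  then have b: "cmod (\<Phi> p) \<le> \<bar>b\<bar>" for p
    using supp(2)[of p] by (cases "cmod p \<le> B") (auto intro: order_trans[OF _ abs_ge_self])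
  \<comment> \<open>The first summand pays for the expansion error, using
    \<open>cmod z \<ge> r / 2\<close>; the second dominates the cost
    \<open>6 * B * \<bar>C\<bar>\<close> of replacing \<open>1 / z\<close>.\<close>
  define K where "K = 4 * \<bar>M\<bar> + 12 * B * \<bar>C\<bar>"
  have K0: "0 \<le> K" using B by (simp add: K_def)
  \<comment> \<open>For \<open>r \<ge> 4 * B\<close> the annulus lies in the region
    \<open>cmod z \<ge> 2 * B\<close> where \<open>est\<close> applies, and \<open>cmod z\<close> is
    comparable to \<open>r\<close> on it.\<close>
  have "cmod ((LINT x|lborel. disc_diff r (fst x) (snd x) *\<^sub>R N (fst x) (snd x)) - pi *\<^sub>R (LINT p|lborel. L p (cnj p)))
      \<le> (K * 4 * pi\<^sup>2 * B ^ 3) * cmod (of_real (1 / r))" if r: "4 * B \<le> r" for r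
  proof -
    have r0: "0 < r" using r B by linarith
    let ?D = "\<lambda>x. disc_diff r (fst x) (snd x)"
    \<comment> \<open>\<open>A1\<close> and \<open>A2\<close> carry the constant and the linear part
      of \<open>E\<close>. In \<open>A2\<close> the numerator \<open>cnj z\<close> stands for
      \<open>1 / z\<close>; the factor \<open>1 / r\<^sup>2\<close> is restored in
      \<open>main\<close>.\<close>
    define A1 where "A1 = (\<lambda>x. ?D x *\<^sub>R \<Phi> (snd x))"
    define A2 where "A2 = (\<lambda>x. ?D x *\<^sub>R L (snd x) (cnj (fst x)))"
    define E where "E = (\<lambda>x. ?D x *\<^sub>R N (fst x) (snd x))"
    have far: "?D x = 0 \<or> B < cmod (snd x)" if "r + B + B < norm x" for x
      using that norm_Pair_le[of "fst x" "snd x"] disc_diff_eq_0[of "snd x" B "fst x" r]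
      by (cases "cmod (snd x) \<le> B") auto
    have [measurable]: "E \<in> borel_measurable borel" "A1 \<in> borel_measurable borel" "A2 \<in> borel_measurable borel"
      unfolding E_def A1_def A2_def
      by (intro borel_measurable_scaleR disc_diff_measurable N(1) \<Phi>' LL)+
    obtain CN where CN: "\<And>z p. cmod z \<le> r + B \<Longrightarrow> cmod (N z p) \<le> CN"
      using N(2)[of "r + B"] by blast
    have iE: "integrable lborel E"
    proof (rule integrable_lborel_bounded_support)
      show "E x = 0" if "r + B + B < norm x" for x
        using far[OF that] supp(1) by (auto simp: E_def)
      show "norm (E x) \<le> \<bar>CN\<bar>" for x
      proof (cases "cmod (fst x) \<le> r + B \<and> cmod (snd x) \<le> B")
        case True
        then have "\<bar>?D x\<bar> * cmod (N (fst x) (snd x)) \<le> 1 * \<bar>CN\<bar>"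
          using CN[of "fst x" "snd x"] by (intro mult_mono abs_disc_diff_le) auto
        then show ?thesis by (simp add: E_def)
      next
        case False
        then have "E x = 0"
          using supp(1)[of "snd x" "fst x"] disc_diff_eq_0[of "snd x" B "fst x" r] by (force simp: E_def)
        then show ?thesis by simp
      qed
    qed measurable
    have iA1: "integrable lborel A1"
    proof (rule integrable_lborel_bounded_support)
      show "A1 x = 0" if "r + B + B < norm x" for x
        using far[OF that] supp(2) by (auto simp: A1_def)
      show "norm (A1 x) \<le> \<bar>b\<bar>" for x
        using mult_mono[OF abs_disc_diff_le[of r "fst x" "snd x"] b[of "snd x"]] by (simp add: A1_def)
    qed measurable
    have iA2: "integrable lborel A2"
    proof (rule integrable_lborel_bounded_support)
      show "A2 x = 0" if "r + B + B < norm x" for x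
        using far[OF that] supp(3) by (auto simp: A2_def)
      show "norm (A2 x) \<le> \<bar>C\<bar> * (r + B)" for x
      proof (cases "cmod (fst x) \<le> r + B \<and> cmod (snd x) \<le> B")
        case True
        then have "cmod (L (snd x) (cnj (fst x))) \<le> \<bar>C\<bar> * (r + B)"
          using C[of "snd x" "cnj (fst x)"] mult_left_mono[of "cmod (fst x)" "r + B" "\<bar>C\<bar>"] by simp
        then have "\<bar>?D x\<bar> * cmod (L (snd x) (cnj (fst x))) \<le> 1 * (\<bar>C\<bar> * (r + B))"
          by (intro mult_mono abs_disc_diff_le) auto
        then show ?thesis by (simp add: A2_def)
      next
        case False
        then have "A2 x = 0"
          using supp(3)[of "snd x" "cnj (fst x)"] disc_diff_eq_0[of "snd x" B "fst x" r] by (force simp: A2_def)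
        then show ?thesis using r0 B by simp
      qed
    qed measurable
    have I1: "(LINT x|lborel. A1 x) = 0"
    proof -
      have "(LINT x|lborel. A1 x) = (LINT p|lborel. LINT z|lborel. A1 (z, p))"
        using lborel_pair.integral_snd[of "\<lambda>z p. A1 (z, p)"] iA1 by (simp add: lborel_prod)
      moreover have "(LINT z|lborel. A1 (z, p)) = 0" for p
      proof (cases "\<Phi> p = 0")
        case False
        then have p: "cmod p \<le> B" using supp(2) by force
        have "integrable lborel (\<lambda>z. disc_diff r z p)"
          using disc_diff_eq_0[OF p] abs_disc_diff_le
          by (intro integrable_lborel_bounded_support[where R = "r + B" and C = 1]) auto
        then show ?thesis by (simp add: A1_def integral_disc_diff)
      qed (simp add: A1_def)
      ultimately show ?thesis by simp
    qed
    have I2: "(LINT x|lborel. A2 x) = (pi * r\<^sup>2) *\<^sub>R (LINT p|lborel. L p (cnj p))"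
    proof -
      have "(LINT x|lborel. A2 x) = (LINT p|lborel. LINT z|lborel. A2 (z, p))"
        using lborel_pair.integral_snd[of "\<lambda>z p. A2 (z, p)"] iA2 by (simp add: lborel_prod)
      moreover have "(LINT z|lborel. A2 (z, p)) = (pi * r\<^sup>2) *\<^sub>R L p (cnj p)" for p
      proof -
        have "linear (\<lambda>z. L p (cnj z))"
          using linear_compose[OF bounded_linear.linear[OF bounded_linear_cnj] L(2)[of p]] by (simp add: o_def)
        from integral_disc_diff_linear[OF this, of r p] r0 show ?thesis by (simp add: A2_def)
      qed
      ultimately show ?thesis by simp
    qed
    \<comment> \<open>All three integrands vanish outside \<open>S\<close>. The quadratic terms in
      the area of the annulus cancel, so the measure of \<open>S\<close> is linear in
      \<open>r\<close>.\<close>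
    define S where "S = (cball (0::complex) (r + B) - ball 0 (r - B)) \<times> cball (0::complex) B"
    have [measurable]: "S \<in> sets borel"
      unfolding S_def by (intro borel_Times) auto
    have eS: "emeasure lborel S = ennreal (4 * pi * r * B) * ennreal (pi * B\<^sup>2)"
    proof -
      have "emeasure lborel (cball (0::complex) (r + B) - ball 0 (r - B))
          = emeasure lborel (cball (0::complex) (r + B)) - emeasure lborel (ball (0::complex) (r - B))"
        using B r0 emeasure_lborel_ball_finite[of "0::complex" "r - B"] by (intro emeasure_Diff) auto
      also have "\<dots> = ennreal (pi * (r + B)\<^sup>2 - pi * (r - B)\<^sup>2)"
        using B r by (simp add: emeasure_cball emeasure_ball unit_ball_vol_2 ennreal_minus)
      also have "pi * (r + B)\<^sup>2 - pi * (r - B)\<^sup>2 = 4 * pi * r * B"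
        by (simp add: power2_eq_square algebra_simps)
      finally have "emeasure lborel (cball (0::complex) (r + B) - ball 0 (r - B)) = ennreal (4 * pi * r * B)" .
      then show ?thesis
        using B unfolding S_def lborel_prod[symmetric]
        by (subst lborel.emeasure_pair_measure_Times) (auto simp: emeasure_cball unit_ball_vol_2)
    qed
    have mS: "measure lborel S = 4 * pi\<^sup>2 * r * B ^ 3"
      using B r0 by (simp add: measure_def eS enn2real_mult power2_eq_square power3_eq_cube)
    have iS: "integrable lborel (\<lambda>x. K / r\<^sup>2 * indicat_real S x)"
      using eS by (simp add: ennreal_mult_less_top)
    have main: "cmod (E x - (A1 x + (1 / r\<^sup>2) *\<^sub>R A2 x)) \<le> K / r\<^sup>2 * indicat_real S x" for x
    proof (cases "x \<in> S")
      case False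
      obtain z p where x: "x = (z, p)" by fastforce
      have "B < cmod p \<or> cmod p \<le> B \<and> cmod z \<notin> {r - B..r + B}" using False by (auto simp: x S_def)
      then have "E x = 0" "A1 x = 0" "A2 x = 0"
        using supp disc_diff_eq_0[of p B z r] by (auto simp: x E_def A1_def A2_def)
      then show ?thesis using K0 by simp
    next
      case True
      obtain z p where x: "x = (z, p)" by fastforce
      have p: "cmod p \<le> B" and z: "r - B \<le> cmod z" "cmod z \<le> r + B"
        using True by (auto simp: x S_def)
      have z2: "r / 2 \<le> cmod z" "2 * B \<le> cmod z" "z \<noteq> 0" using z r r0 B by auto
      \<comment> \<open>The numerator factors as \<open>(r + cmod z) * (r - cmod z)\<close> and is
        thus only of order \<open>r\<close> on the annulus, against a denominator of order
        \<open>r ^ 3\<close>.\<close>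
      have "1 / z - cnj z / of_real (r\<^sup>2) = of_real (r\<^sup>2 - (cmod z)\<^sup>2) / (z * of_real (r\<^sup>2))"
        using z2 r0 complex_norm_square[of z] by (simp add: field_simps)
      also have "cmod \<dots> = \<bar>r\<^sup>2 - (cmod z)\<^sup>2\<bar> / (cmod z * r\<^sup>2)"
        by (simp only: norm_divide norm_mult norm_of_real) simp
      also have "\<dots> \<le> (3 * r * B) / (r / 2 * r\<^sup>2)"
      proof (rule frac_le)
        have "\<bar>r\<^sup>2 - (cmod z)\<^sup>2\<bar> = (r + cmod z) * \<bar>r - cmod z\<bar>"
          using r0 by (simp add: square_diff_square_factored power2_eq_square abs_mult)
        also have "\<dots> \<le> (3 * r) * B"
          using z r r0 B by (intro mult_mono) auto
        finally show "\<bar>r\<^sup>2 - (cmod z)\<^sup>2\<bar> \<le> 3 * r * B" .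
      qed (use z2 r0 B in auto)
      also have "\<dots> = 6 * B / r\<^sup>2" using r0 by (simp add: field_simps power2_eq_square)
      finally have inv: "cmod (1 / z - cnj z / of_real (r\<^sup>2)) \<le> 6 * B / r\<^sup>2" .
      have "cnj z / of_real (r\<^sup>2) = (1 / r\<^sup>2) *\<^sub>R cnj z"
        by (simp add: scaleR_conv_of_real)
      then have "L p (1 / z) - (1 / r\<^sup>2) *\<^sub>R L p (cnj z) = L p (1 / z - cnj z / of_real (r\<^sup>2))"
        by (simp only: linear_diff[OF L(2)] linear_cmul[OF L(2)])
      then have Lz: "cmod (L p (1 / z) - (1 / r\<^sup>2) *\<^sub>R L p (cnj z)) \<le> \<bar>C\<bar> * (6 * B / r\<^sup>2)"
        using order_trans[OF C mult_left_mono[OF inv]] by simp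
      have Mz: "M / (cmod z)\<^sup>2 \<le> 4 * \<bar>M\<bar> / r\<^sup>2"
      proof -
        have "M / (cmod z)\<^sup>2 \<le> \<bar>M\<bar> / (r / 2)\<^sup>2"
          using z2 r0 by (intro frac_le power_mono) auto
        then show ?thesis by (simp add: power_divide mult.commute)
      qed
      have "cmod (E x - (A1 x + (1 / r\<^sup>2) *\<^sub>R A2 x))
          = \<bar>disc_diff r z p\<bar> * cmod ((N z p - \<Phi> p - L p (1 / z)) + (L p (1 / z) - (1 / r\<^sup>2) *\<^sub>R L p (cnj z)))"
        unfolding norm_scaleR[symmetric] by (simp add: x E_def A1_def A2_def algebra_simps)
      also have "\<dots> \<le> 1 * (4 * \<bar>M\<bar> / r\<^sup>2 + \<bar>C\<bar> * (6 * B / r\<^sup>2))"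
        using order_trans[OF est[OF p z2(2)] Mz] Lz
        by (intro mult_mono abs_disc_diff_le norm_triangle_mono) auto
      also have "\<dots> \<le> K / r\<^sup>2"
        using B r0 by (simp add: K_def field_simps)
      finally show ?thesis using True by simp
    qed
    \<comment> \<open>The factor \<open>r\<^sup>2\<close> in \<open>I2\<close> cancels
      \<open>1 / r\<^sup>2\<close>, so the claimed limit is split off exactly. What remains is at
      most \<open>K / r\<^sup>2\<close> on a set of measure of order \<open>r\<close>.\<close>
    have "(LINT x|lborel. E x) - pi *\<^sub>R (LINT p|lborel. L p (cnj p))
        = (LINT x|lborel. E x - (A1 x + (1 / r\<^sup>2) *\<^sub>R A2 x))"
      using iE iA1 iA2 I1 I2 r0 by simp
    also have "cmod \<dots> \<le> (LINT x|lborel. K / r\<^sup>2 * indicat_real S x)"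
      using iE iA1 iA2 iS main by (intro Bochner_Integration.integral_norm_bound_integral) auto
    also have "\<dots> = K / r\<^sup>2 * (4 * pi\<^sup>2 * r * B ^ 3)"
      using mS by simp
    also have "\<dots> = (K * 4 * pi\<^sup>2 * B ^ 3) * cmod (of_real (1 / r))"
      using r0 by (simp add: power2_eq_square norm_divide)
    finally show ?thesis by (simp add: E_def)
  qed
  then show ?thesis
    by (intro bigoI[where c = "K * 4 * pi\<^sup>2 * B ^ 3"] eventually_at_top_linorderI[of "4 * B"]) auto
qed


section \<open>The cutoff integral\<close>

lemma lborel_integral_orthogonal_transformation:
  fixes f :: "'a::euclidean_space \<Rightarrow> 'a" and h :: "'a \<Rightarrow> 'b::{banach, second_countable_topology}"
  assumes f: "orthogonal_transformation f" and [measurable]: "h \<in> borel_measurable borel"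
  shows "(LINT x|lborel. h (f x)) = (LINT x|lborel. h x)"
proof -
  have [measurable]: "f \<in> borel_measurable borel"
    using f by (intro borel_measurable_continuous_onI linear_continuous_on)
      (simp add: orthogonal_transformation linear_conv_bounded_linear)
  have "(LINT x|lborel. h x) = (LINT x|distr lborel borel f. h x)"
    by (simp add: lborel_distr_orthogonal_transformation[OF f])
  also have "\<dots> = (LINT x|lborel. h (f x))"
    by (subst integral_distr) auto
  finally show ?thesis ..
qed

lemma lborel_integral_rotate:
  fixes h :: "complex \<Rightarrow> 'b::{banach, second_countable_topology}"
  assumes "cmod u = 1" and "h \<in> borel_measurable borel"
  shows "(LINT x|lborel. h (u * x)) = (LINT x|lborel. h x)"
  using assms
  by (intro lborel_integral_orthogonal_transformation)
    (auto simp: orthogonal_transformation norm_mult linear_times)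

text \<open>On the complement of the null set \<open>z = 0\<close> this is the change of the fibre coordinate from the
  chart \<open>x\<close> to the dotted chart.\<close>

definition rotated :: "(complex \<Rightarrow> complex \<Rightarrow> complex) \<Rightarrow> complex \<Rightarrow> complex \<Rightarrow> complex"
  where "rotated k z p = (if z = 0 then 0 else k z (cnj z / z * p))"

text \<open>The factor \<open>cnj z / z\<close> has no limit at \<open>z = 0\<close>, so continuity
  of \<open>k\<close> does not carry over and measurability is all that is claimed.\<close>

lemma rotated_measurable:
  assumes "continuous_on UNIV (\<lambda>x. k (fst x) (snd x))"
  shows "(\<lambda>x. rotated k (fst x) (snd x)) \<in> borel_measurable borel"
proof -
  have k: "(\<lambda>x. k (fst x) (snd x)) \<in> borel_measurable borel"
    using assms by (rule borel_measurable_continuous_onI)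
  have c: "(\<lambda>x::complex \<times> complex. cnj (fst x)) \<in> borel_measurable borel"
    "(\<lambda>x::complex \<times> complex. fst x) \<in> borel_measurable borel"
    "(\<lambda>x::complex \<times> complex. snd x) \<in> borel_measurable borel"
    by (intro borel_measurable_continuous_onI continuous_intros)+
  have "(\<lambda>x::complex \<times> complex. (fst x, cnj (fst x) / fst x * snd x)) \<in> borel_measurable borel"
    by (intro borel_measurable_Pair borel_measurable_times borel_measurable_divide c)
  from measurable_compose[OF this k]
  have "(\<lambda>x. k (fst x) (cnj (fst x) / fst x * snd x)) \<in> borel_measurable borel" by simp
  moreover have "{x::complex \<times> complex. fst x = 0} \<in> sets borel"
    by (intro borel_closed closed_Collect_eq continuous_intros)
  ultimately show ?thesis
    unfolding rotated_def by (intro measurable_If) auto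
qed

text \<open>Only \<open>z\<close> has to be cut off: \<open>w\<close> is already confined to a disc,
  so compactness of a product of two discs suffices.\<close>

lemma fibre_supported_bounded:
  fixes k :: "complex \<Rightarrow> complex \<Rightarrow> complex"
  assumes k: "continuous_on UNIV (\<lambda>x. k (fst x) (snd x))"
    and supp: "\<And>z w. B < cmod w \<Longrightarrow> k z w = 0"
  shows "\<exists>C\<ge>0. \<forall>z w. cmod z \<le> R \<longrightarrow> cmod (k z w) \<le> C"
proof -
  have "\<exists>b. \<forall>x \<in> cball 0 R \<times> cball 0 B. cmod (k (fst x) (snd x)) \<le> b"
    using compact_imp_bounded[OF compact_continuous_image[OF continuous_on_subset[OF k] compact_Times[OF compact_cball compact_cball]]]
    by (auto simp: bounded_iff)
  then obtain b where b: "\<And>z w. cmod z \<le> R \<Longrightarrow> cmod w \<le> B \<Longrightarrow> cmod (k z w) \<le> b"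
    by force
  have "cmod (k z w) \<le> \<bar>b\<bar>" if "cmod z \<le> R" for z w
    using b[OF that, of w] supp[of w z] by (cases "cmod w \<le> B") auto
  then show ?thesis by (intro exI[of _ "\<bar>b\<bar>"]) auto
qed

lemma rotated_bounded:
  assumes "continuous_on UNIV (\<lambda>x. k (fst x) (snd x))"
    and "\<And>z w. B < cmod w \<Longrightarrow> k z w = 0"
  shows "\<exists>C. \<forall>z p. cmod z \<le> R \<longrightarrow> cmod (rotated k z p) \<le> C"
proof -
  obtain C where "C \<ge> 0" "\<And>z w. cmod z \<le> R \<Longrightarrow> cmod (k z w) \<le> C"
    using fibre_supported_bounded[of k B R] assms by blast
  then show ?thesis by (intro exI[of _ C]) (auto simp: rotated_def)
qed

text \<open>By Fubini both terms of \<open>h\<close> become integrals over pairs. Substituting the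
  inverse arrow moves the cutoff of the second term from \<open>z\<close> to
  \<open>z + cnj w\<close>, and the fibre rotation turns this into a cutoff on
  \<open>z + p\<close>.\<close>

lemma cutoff_integral_eq:
  fixes k :: "complex \<Rightarrow> complex \<Rightarrow> complex" and B r :: real
  assumes k: "continuous_on UNIV (\<lambda>x. k (fst x) (snd x))"
    and supp: "\<And>z w. B < cmod w \<Longrightarrow> k z w = 0"
  defines "h \<equiv> \<lambda>z. (LINT w|lborel. k z w) - (LINT w|lborel. k (z + cnj w) (- w))"
  shows "set_integrable lborel (cball 0 r) h"
    and "(LINT z:cball 0 r|lborel. h z) = (LINT x|lborel. disc_diff r (fst x) (snd x) *\<^sub>R rotated k (fst x) (snd x))"
proof -
  let ?I = "\<lambda>z. indicat_real (cball (0::complex) r) z"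
  \<comment> \<open>\<open>G1\<close> and \<open>G2\<close> are the cut off terms of
    \<open>h\<close>, \<open>G3\<close> is \<open>G2\<close> after the substitution, and
    \<open>G4\<close> is \<open>G1 - G3\<close> in the rotated fibre coordinate.\<close>
  define G1 where "G1 = (\<lambda>x. ?I (fst x) *\<^sub>R k (fst x) (snd x))"
  define G2 where "G2 = (\<lambda>x. ?I (fst x) *\<^sub>R k (fst x + cnj (snd x)) (- snd x))"
  define G3 where "G3 = (\<lambda>x. ?I (fst x + cnj (snd x)) *\<^sub>R k (fst x) (snd x))"
  define G4 where "G4 = (\<lambda>x. disc_diff r (fst x) (snd x) *\<^sub>R rotated k (fst x) (snd x))"
  have I: "indicat_real (cball (0::complex) r) \<in> borel_measurable borel"
    by (rule borel_measurable_indicator) simp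
  have I_meas: "(\<lambda>x. ?I (T x)) \<in> borel_measurable borel"
    if "continuous_on UNIV T" for T :: "complex \<times> complex \<Rightarrow> complex"
    using measurable_compose[OF borel_measurable_continuous_onI[OF that] I] .
  have k_cont: "continuous_on UNIV (\<lambda>x. k (S x) (T x))" if "continuous_on UNIV S" "continuous_on UNIV T"
    for S T :: "complex \<times> complex \<Rightarrow> complex"
    using continuous_on_compose2[OF k continuous_on_Pair[OF that]] by simp
  obtain b where b: "\<And>z w. cmod z \<le> \<bar>r\<bar> + \<bar>B\<bar> \<Longrightarrow> cmod (k z w) \<le> b"
    using fibre_supported_bounded[of k B "\<bar>r\<bar> + \<bar>B\<bar>"] k supp by blast
  obtain b' where b': "\<And>z w. cmod z \<le> \<bar>r\<bar> + \<bar>B\<bar> \<Longrightarrow> cmod (rotated k z w) \<le> b'"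
    using rotated_bounded[of k B "\<bar>r\<bar> + \<bar>B\<bar>"] k supp by blast
  have integrableI: "integrable lborel G"
    if "G \<in> borel_measurable borel"
      "\<And>z w. cmod w \<le> B \<Longrightarrow> cmod z \<le> \<bar>r\<bar> + \<bar>B\<bar> \<Longrightarrow> cmod (G (z, w)) \<le> c"
      "\<And>z w. B < cmod w \<or> \<bar>r\<bar> + \<bar>B\<bar> < cmod z \<Longrightarrow> G (z, w) = 0" for G c
  proof (rule integrable_lborel_bounded_support)
    fix x :: "complex \<times> complex"
    obtain z w where x: "x = (z, w)" by fastforce
    show "cmod (G x) \<le> \<bar>c\<bar>"
      using that(2)[of w z] that(3)[of w z] by (cases "cmod w \<le> B \<and> cmod z \<le> \<bar>r\<bar> + \<bar>B\<bar>") (auto simp: x)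
    show "G x = 0" if "(\<bar>r\<bar> + \<bar>B\<bar>) + B < norm x"
      using that \<open>\<And>z w. B < cmod w \<or> _ < cmod z \<Longrightarrow> G (z, w) = 0\<close>[of w z] norm_Pair_le[of z w]
      by (force simp: x)
  qed fact
  have near: "cmod z \<le> \<bar>r\<bar> + \<bar>B\<bar>" if "cmod (z + w) \<le> r" "cmod w \<le> B" for z w
    using that norm_triangle_ineq4[of "z + w" w] by auto
  have i1: "integrable lborel G1"
  proof (rule integrableI[where c = b])
    show "G1 \<in> borel_measurable borel"
      unfolding G1_def by (intro borel_measurable_scaleR I_meas borel_measurable_continuous_onI k_cont continuous_intros)
  qed (use b supp in \<open>auto simp: G1_def indicator_def intro: order_trans[OF norm_ge_zero]\<close>)
  have i2: "integrable lborel G2"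
  proof (rule integrableI[where c = b])
    show "G2 \<in> borel_measurable borel"
      unfolding G2_def by (intro borel_measurable_scaleR I_meas borel_measurable_continuous_onI k_cont continuous_intros)
    fix z w
    have "cmod (z + cnj w) \<le> \<bar>r\<bar> + \<bar>B\<bar>" if "cmod w \<le> B" "cmod z \<le> r"
      using that norm_triangle_ineq[of z "cnj w"] by auto
    then show "cmod (G2 (z, w)) \<le> b" if "cmod w \<le> B" "cmod z \<le> \<bar>r\<bar> + \<bar>B\<bar>"
      using that b[of "z + cnj w" "- w"] order_trans[OF norm_ge_zero b[OF that(2)]] by (auto simp: G2_def indicator_def)
  qed (use supp in \<open>auto simp: G2_def indicator_def\<close>)
  have i3: "integrable lborel G3"
  proof (rule integrableI[where c = b])
    show "G3 \<in> borel_measurable borel"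
      unfolding G3_def by (intro borel_measurable_scaleR I_meas borel_measurable_continuous_onI k_cont continuous_intros)
    fix z w
    show "cmod (G3 (z, w)) \<le> b" if "cmod w \<le> B" "cmod z \<le> \<bar>r\<bar> + \<bar>B\<bar>"
      using that b[of z w] order_trans[OF norm_ge_zero b[OF that(2)]] by (auto simp: G3_def indicator_def)
    show "G3 (z, w) = 0" if "B < cmod w \<or> \<bar>r\<bar> + \<bar>B\<bar> < cmod z"
      using that supp[of w z] near[of z "cnj w"] by (force simp: G3_def indicator_def)
  qed
  have i4: "integrable lborel G4"
  proof (rule integrableI[where c = b'])
    show "G4 \<in> borel_measurable borel"
      unfolding G4_def by (intro borel_measurable_scaleR disc_diff_measurable rotated_measurable k)
    fix z w
    show "cmod (G4 (z, w)) \<le> b'" if "cmod w \<le> B" "cmod z \<le> \<bar>r\<bar> + \<bar>B\<bar>"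
      using mult_mono[OF abs_disc_diff_le[of r z w] b'[OF that(2), of w]] by (simp add: G4_def)
    have "rotated k z w = 0" if "B < cmod w"
      using that supp by (auto simp: rotated_def norm_mult norm_divide)
    then show "G4 (z, w) = 0" if "B < cmod w \<or> \<bar>r\<bar> + \<bar>B\<bar> < cmod z"
      using that disc_diff_eq_0[of w B z r] by (force simp: G4_def)
  qed
  note fst_eq = lborel_pair.integral_fst'[unfolded lborel_prod] and snd_eq = lborel_pair.integral_snd[of "\<lambda>z w. G (z, w)" for G, simplified, unfolded lborel_prod]
  have hG: "?I z *\<^sub>R h z = (LINT w|lborel. G1 (z, w)) - (LINT w|lborel. G2 (z, w))" for z
    by (simp add: h_def G1_def G2_def scaleR_diff_right)
  have i1': "integrable lborel (\<lambda>z. LINT w|lborel. G1 (z, w))"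
    and i2': "integrable lborel (\<lambda>z. LINT w|lborel. G2 (z, w))"
    using lborel_pair.integrable_fst'[unfolded lborel_prod] i1 i2 by blast+
  show "set_integrable lborel (cball 0 r) h"
    unfolding set_integrable_def hG using i1' i2' by (rule Bochner_Integration.integrable_diff)
  \<comment> \<open>The substitution is carried out in two measure preserving steps: a translation
    of \<open>z\<close> by \<open>cnj w\<close> for fixed \<open>w\<close>, then the reflection of
    \<open>w\<close>.\<close>
  have "(LINT x|lborel. G2 x) = (LINT w|lborel. LINT z|lborel. G2 (z, w))"
    using snd_eq[OF i2] by simp
  also have "\<dots> = (LINT w|lborel. LINT z|lborel. G3 (z, - w))"
  proof (rule Bochner_Integration.integral_cong[OF refl])
    fix w
    have "(\<lambda>z. G3 (z, - w)) \<in> borel_measurable borel"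
      using borel_measurable_integrable[OF i3] by (intro measurable_compose[OF _ borel_measurable_integrable[OF i3, simplified]]) simp
    from lborel_integral_plus[OF this, of "cnj w"]
    show "(LINT z|lborel. G2 (z, w)) = (LINT z|lborel. G3 (z, - w))"
      by (simp add: G2_def G3_def)
  qed
  also have "\<dots> = (LINT w|lborel. LINT z|lborel. G3 (z, w))"
    using lborel_integral_orthogonal_transformation[of uminus "\<lambda>w. LINT z|lborel. G3 (z, w)"]
      borel_measurable_integrable[OF lborel_pair.integrable_snd[of "\<lambda>z w. G3 (z, w)", simplified, unfolded lborel_prod, OF i3]]
    by (simp add: orthogonal_transformation linear_uminus)
  also have "\<dots> = (LINT x|lborel. G3 x)"
    using snd_eq[OF i3] by simp
  finally have G23: "(LINT x|lborel. G2 x) = (LINT x|lborel. G3 x)" .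
  have "(LINT z:cball 0 r|lborel. h z) = (LINT x|lborel. G1 x) - (LINT x|lborel. G2 x)"
    unfolding set_lebesgue_integral_def hG
    by (simp add: Bochner_Integration.integral_diff[OF i1' i2'] fst_eq[OF i1] fst_eq[OF i2])
  also have "\<dots> = (LINT x|lborel. G1 x - G3 x)"
    by (simp add: G23 Bochner_Integration.integral_diff[OF i1 i3])
  also have "\<dots> = (LINT z|lborel. LINT w|lborel. G1 (z, w) - G3 (z, w))"
    using fst_eq[OF Bochner_Integration.integrable_diff[OF i1 i3]] by simp
  \<comment> \<open>At \<open>z = 0\<close> the rotation is undefined and \<open>rotated\<close>
    takes the default value \<open>0\<close>; equality almost everywhere is enough.\<close>
  also have "\<dots> = (LINT z|lborel. LINT p|lborel. G4 (z, p))"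
  proof (rule integral_cong_AE)
    show "(\<lambda>z. LINT w|lborel. G1 (z, w) - G3 (z, w)) \<in> borel_measurable lborel"
      using lborel_pair.integrable_fst'[unfolded lborel_prod, OF Bochner_Integration.integrable_diff[OF i1 i3]]
      by (rule borel_measurable_integrable)
    show "(\<lambda>z. LINT p|lborel. G4 (z, p)) \<in> borel_measurable lborel"
      using lborel_pair.integrable_fst'[unfolded lborel_prod, OF i4] by (rule borel_measurable_integrable)
    have "(LINT w|lborel. G1 (z, w) - G3 (z, w)) = (LINT p|lborel. G4 (z, p))" if z: "z \<noteq> 0" for z
    proof -
      define u where "u = cnj z / z"
      have u: "cmod u = 1" using z by (simp add: u_def norm_divide)
      have "(\<lambda>w. G1 (z, w) - G3 (z, w)) \<in> borel_measurable borel"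
        by (intro measurable_compose[OF _ borel_measurable_integrable[OF Bochner_Integration.integrable_diff[OF i1 i3], simplified]]) simp
      from lborel_integral_rotate[OF u this]
      have "(LINT w|lborel. G1 (z, w) - G3 (z, w)) = (LINT p|lborel. G1 (z, u * p) - G3 (z, u * p))" by simp
      also have "\<dots> = (LINT p|lborel. G4 (z, p))"
      proof (rule Bochner_Integration.integral_cong[OF refl])
        fix p
        \<comment> \<open>The prefactor \<open>z / cnj z\<close> is unimodular, so the cutoff sees
          only \<open>cmod (z + p)\<close>.\<close>
        have "z + cnj (u * p) = z / cnj z * cnj (z + p)"
          using z by (simp add: u_def field_simps)
        then have "cmod (z + cnj (u * p)) = cmod (z + p)"
          using z by (simp only: norm_mult norm_divide complex_mod_cnj) simp
        then show "G1 (z, u * p) - G3 (z, u * p) = G4 (z, p)"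
          using z by (simp add: G1_def G3_def G4_def rotated_def disc_diff_def u_def indicator_def scaleR_diff_left)
      qed
      finally show ?thesis .
    qed
    then show "AE z in lborel. (LINT w|lborel. G1 (z, w) - G3 (z, w)) = (LINT p|lborel. G4 (z, p))"
      using AE_lborel_singleton[of "0::complex"] by (auto elim: eventually_mono)
  qed
  also have "\<dots> = (LINT x|lborel. G4 x)" by (rule fst_eq[OF i4])
  finally show "(LINT z:cball 0 r|lborel. h z) = (LINT x|lborel. disc_diff r (fst x) (snd x) *\<^sub>R rotated k (fst x) (snd x))"
    by (simp add: G4_def)
qed


section \<open>The trace defect formula\<close>

text \<open>Well defined on arrows because the transition multiplies the fibre coordinate by a
  number of modulus 1.\<close>

lift_definition fibre_norm :: "arrow \<Rightarrow> real" is "case_sum (\<lambda>(z, w). cmod w) (\<lambda>(z, w). cmod w)"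
  by (elim glued.elims) (auto simp: norm_mult norm_divide norm_power)

lemma fibre_norm_simps [simp]:
  "fibre_norm (chart_x z w) = cmod w" "fibre_norm (chart_xdot z w) = cmod w"
  by (transfer, simp)+

lemma continuous_on_fibre_norm: "continuous_on A fibre_norm"
proof -
  have "open (fibre_norm -` U)" if "open U" for U
  proof -
    have "case_prod chart_x -` fibre_norm -` U = (\<lambda>x. cmod (snd x)) -` U"
      "case_prod chart_xdot -` fibre_norm -` U = (\<lambda>x. cmod (snd x)) -` U"
      by auto
    moreover have "open ((\<lambda>x::complex \<times> complex. cmod (snd x)) -` U)"
      using that by (intro open_vimage continuous_intros)
    ultimately show ?thesis by (simp add: open_arrow_def)
  qed
  then have "continuous_on UNIV fibre_norm"
    by (simp add: continuous_on_open_vimage)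
  then show ?thesis by (rule continuous_on_subset) simp
qed

text \<open>A continuous function is bounded on a compact support, so one radius serves all fibres,
  the singular one included.\<close>

lemma compactly_supported_fibre_norm:
  fixes g :: "arrow \<Rightarrow> 'b::zero"
  assumes "compactly_supported g"
  obtains B where "1 \<le> B" "\<And>a. B < fibre_norm a \<Longrightarrow> g a = 0"
proof -
  have "bounded (fibre_norm ` closure {a. g a \<noteq> 0})"
    using assms unfolding compactly_supported_def
    by (intro compact_imp_bounded compact_continuous_image continuous_on_fibre_norm)
  then obtain b where b: "\<And>a. a \<in> closure {a. g a \<noteq> 0} \<Longrightarrow> \<bar>fibre_norm a\<bar> \<le> b"
    by (auto simp: bounded_iff)
  have "g a = 0" if "max 1 b < fibre_norm a" for a
    using b[of a] closure_subset[of "{a. g a \<noteq> 0}"] that by force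
  then show thesis by (intro that[of "max 1 b"]) auto
qed

section \<open>Arrows and the convolution kernel in the dotted chart\<close>

lemma chart_x_rotate:
  assumes "z \<noteq> 0"
  shows "chart_x z (cnj z / z * p) = chart_xdot (1 / z) p"
  using assms complex_norm_square[of z]
  by (simp add: chart_transition power2_eq_square field_simps)

text \<open>The inverse arrow starts at \<open>z * (1 + cnj c)\<close>, which is nonzero by
  hypothesis, so the change of chart applies at that point. This is the origin of the formula in
  \<open>leaf_kernel\<close>.\<close>

lemma chart_x_inv_rotate:
  assumes z: "z \<noteq> 0" and nz: "1 + 1 / z * p \<noteq> 0"
  defines "c \<equiv> 1 / z * p"
  shows "chart_x (z + cnj (cnj z / z * p)) (- (cnj z / z * p)) =
    chart_xdot (1 / z / (1 + cnj c)) (- ((1 + cnj c) / (1 + c) * p))"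
proof -
  have c': "1 + cnj c \<noteq> 0"
    using nz by (metis c_def complex_cnj_add complex_cnj_one complex_cnj_zero_iff)
  define z1 where "z1 = z * (1 + cnj c)"
  have z1: "z1 \<noteq> 0" using z c' by (simp add: z1_def)
  have c1: "1 + c \<noteq> 0" using nz by (simp add: c_def)
  have e1: "z + cnj (cnj z / z * p) = z1"
    using z by (simp add: z1_def c_def field_simps)
  have e2: "cnj z1 / z1 * - ((1 + cnj c) / (1 + c) * p) = - (cnj z / z * p)"
  proof -
    have "cnj z1 = cnj z * (1 + c)" by (simp add: z1_def)
    then show ?thesis using z c1 c' by (simp add: z1_def)
  qed
  have e3: "1 / z1 = 1 / z / (1 + cnj c)" by (simp add: z1_def)
  show ?thesis
    using chart_x_rotate[OF z1, of "- ((1 + cnj c) / (1 + c) * p)"] unfolding e1 e2 e3 .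
qed

definition convolution_kernel :: "(arrow \<Rightarrow> complex) \<Rightarrow> (arrow \<Rightarrow> complex) \<Rightarrow> complex \<Rightarrow> complex \<Rightarrow> complex"
  where "convolution_kernel f g z w = f (chart_x (z + cnj w) (- w)) * g (chart_x z w)"

text \<open>Exchanging \<open>f\<close> and \<open>g\<close> amounts to evaluating the kernel at the
  inverse arrow, because inversion is an involution.\<close>

lemma convolution_commutator_unit:
  "(f \<star> g) (unit_at (cp1_z1 z)) - (g \<star> f) (unit_at (cp1_z1 z)) =
    (LINT w|lborel. convolution_kernel f g z w) - (LINT w|lborel. convolution_kernel f g (z + cnj w) (- w))"
  unfolding convolution_unit convolution_kernel_def by (simp add: mult.commute)

lemma rotated_convolution_kernel:
  assumes "z \<noteq> 0" and "1 + 1 / z * p \<noteq> 0"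
  shows "rotated (convolution_kernel f g) z p =
    leaf_kernel (\<lambda>(z, w). f (chart_xdot z w)) (\<lambda>(z, w). g (chart_xdot z w)) (1 / z) p"
  unfolding rotated_def convolution_kernel_def leaf_kernel_def if_not_P[OF assms(1)]
    chart_x_rotate[OF assms(1)] chart_x_inv_rotate[OF assms] prod.case ..

section \<open>The first-order term at the singular leaf\<close>

text \<open>\<open>C_k\<close> gives continuity in \<open>x\<close> for fixed \<open>v\<close>;
  joint continuity follows by expanding \<open>v\<close> in the basis.\<close>

lemma C_1_derivative_continuous:
  fixes f :: "'a::euclidean_space \<Rightarrow> 'b::real_normed_vector"
  assumes f: "C_k (Suc 0) f"
  shows "continuous_on UNIV (\<lambda>(x, v). frechet_derivative f (at x) v)"
proof -
  have eq: "frechet_derivative f (at x) v = (\<Sum>b\<in>Basis. (v \<bullet> b) *\<^sub>R frechet_derivative f (at x) b)" for x v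
    by (subst (1) euclidean_representation[of v, symmetric])
      (simp add: linear_sum[OF C_k_Suc_linear[OF f]] linear_cmul[OF C_k_Suc_linear[OF f]])
  have "(\<lambda>(x, v). frechet_derivative f (at x) v)
      = (\<lambda>x. \<Sum>b\<in>Basis. (snd x \<bullet> b) *\<^sub>R frechet_derivative f (at (fst x)) b)"
    by (intro ext) (simp only: case_prod_beta, rule eq)
  moreover have "continuous_on UNIV (\<lambda>x::'a \<times> 'a. frechet_derivative f (at (fst x)) b)" for b
    by (rule continuous_on_compose2[where g = "\<lambda>x. frechet_derivative f (at x) b" and t = UNIV])
      (auto intro!: C_k_continuous_on C_k_Suc_directional f continuous_intros simp del: C_k.simps)
  ultimately show ?thesis by (auto intro!: continuous_intros)
qed

lemma leaf_linear_term_continuous: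
  assumes F: "C_k (Suc 0) F" and G: "C_k (Suc 0) G"
  shows "continuous_on UNIV (\<lambda>x. leaf_linear_term F G (fst x) (snd x))"
proof -
  have D: "continuous_on UNIV (\<lambda>x. frechet_derivative H (at (S x)) (T x))"
    if "C_k (Suc 0) H" "continuous_on UNIV S" "continuous_on UNIV T"
    for H :: "complex \<times> complex \<Rightarrow> complex" and S T :: "complex \<times> complex \<Rightarrow> complex \<times> complex"
    using continuous_on_compose2[OF C_1_derivative_continuous[OF that(1)] continuous_on_Pair[OF that(2,3)]] by simp
  show ?thesis
    unfolding leaf_linear_term_def
    by (intro continuous_intros D F G continuous_on_compose2[OF C_k_continuous_on[OF F, of UNIV]]
        continuous_on_compose2[OF C_k_continuous_on[OF G, of UNIV]]) auto
qed

lemma leaf_linear_term_linear: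
  assumes F: "C_k (Suc 0) F" and G: "C_k (Suc 0) G"
  shows "linear (leaf_linear_term F G p)"
proof (rule linearI)
  note F' = C_k_Suc_linear[OF F, of "(0, - p)"] and G' = C_k_Suc_linear[OF G, of "(0, p)"]
  fix x y :: complex and c :: real
  have eqs: "(x + y, ((x + y) * p - cnj ((x + y) * p)) * p)
      = (x, (x * p - cnj (x * p)) * p) + (y, (y * p - cnj (y * p)) * p)"
    "(c *\<^sub>R x, (c *\<^sub>R x * p - cnj (c *\<^sub>R x * p)) * p) = c *\<^sub>R (x, (x * p - cnj (x * p)) * p)"
    "(x + y, 0) = (x, 0) + (y, 0 :: complex)" "(c *\<^sub>R x, 0) = c *\<^sub>R (x, 0 :: complex)"
    by (auto simp: algebra_simps)
  show "leaf_linear_term F G p (x + y) = leaf_linear_term F G p x + leaf_linear_term F G p y"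
    unfolding leaf_linear_term_def eqs linear_add[OF F'] linear_add[OF G'] by (simp add: algebra_simps)
  show "leaf_linear_term F G p (c *\<^sub>R x) = c *\<^sub>R leaf_linear_term F G p x"
    unfolding leaf_linear_term_def eqs linear_cmul[OF F'] linear_cmul[OF G'] by (simp add: algebra_simps)
qed

lemma frechet_derivative_eq_0:
  assumes "open U" "x \<in> U" and "\<And>y. y \<in> U \<Longrightarrow> f y = 0"
  shows "frechet_derivative f (at x) = (\<lambda>_. 0)"
proof -
  have "(f has_derivative (\<lambda>_. 0)) (at x)"
    by (rule has_derivative_transform_within_open[OF has_derivative_const assms(1,2)]) (simp add: assms(3))
  then show ?thesis by (rule frechet_derivative_at[symmetric])
qed

lemma partial_eq_frechet_derivative:
  assumes "(\<phi> has_derivative D) (at \<zeta>)"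
  shows "partial_x \<phi> \<zeta> = D 1" "partial_y \<phi> \<zeta> = D \<i>"
proof -
  have "((\<lambda>t. \<phi> (\<zeta> + v * of_real t)) has_vector_derivative D v) (at (0::real))" for v
  proof -
    have "((\<lambda>t::real. \<zeta> + v * of_real t) has_derivative (\<lambda>t. v * of_real t)) (at 0)"
      by (auto intro!: derivative_eq_intros)
    from has_derivative_compose[OF this, of \<phi> D] assms
    have "((\<lambda>t. \<phi> (\<zeta> + v * of_real t)) has_derivative (\<lambda>t. D (v * of_real t))) (at 0)" by simp
    moreover have "D (v * of_real t) = t *\<^sub>R D v" for t
      using linear_cmul[OF has_derivative_linear[OF assms], of t v] by (simp add: scaleR_conv_of_real mult.commute)
    ultimately show ?thesis by (simp add: has_vector_derivative_def)
  qed
  from vector_derivative_at[OF this[of 1]] vector_derivative_at[OF this[of \<i>]]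
  show "partial_x \<phi> \<zeta> = D 1" "partial_y \<phi> \<zeta> = D \<i>" by (simp_all add: partial_x_def partial_y_def)
qed

text \<open>For \<open>\<zeta> = cnj p\<close> the fibre component of the direction in \<open>leaf_linear_term\<close> vanishes, so that
  only derivatives along \<open>\<zeta>\<close> survive.\<close>

lemma leaf_linear_term_cnj:
  assumes F: "C_k (Suc 0) F" and G: "C_k (Suc 0) G"
  defines "\<phi> \<equiv> \<lambda>w \<zeta>. F (\<zeta>, cnj w) * G (\<zeta>, - cnj w)"
  shows "leaf_linear_term F G (- cnj w) (cnj (- cnj w))
    = - (of_real (Re w) * partial_x (\<phi> w) 0 + of_real (Im w) * partial_y (\<phi> w) 0)"
proof -
  define D where "D = (\<lambda>v. frechet_derivative F (at (0, cnj w)) (v, 0) * G (0, - cnj w)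
      + F (0, cnj w) * frechet_derivative G (at (0, - cnj w)) (v, 0))"
  have pair: "((\<lambda>\<zeta>. (\<zeta>, q)) has_derivative (\<lambda>v. (v, 0))) (at 0)" for q :: complex
    by (auto intro!: derivative_eq_intros)
  have D: "(\<phi> w has_derivative D) (at 0)"
    unfolding \<phi>_def D_def
    using has_derivative_mult[OF has_derivative_compose[OF pair C_k_Suc_has_derivative[OF F]]
        has_derivative_compose[OF pair C_k_Suc_has_derivative[OF G]]]
    by (simp add: add.commute)
  \<comment> \<open>Here \<open>\<zeta> * p = w * cnj w\<close> is real, so it cancels against its
    conjugate.\<close>
  have "leaf_linear_term F G (- cnj w) (cnj (- cnj w)) = D (- w)"
    by (simp add: leaf_linear_term_def D_def mult.commute)
  also have "- w = - (Re w *\<^sub>R 1 + Im w *\<^sub>R \<i>)" by (simp add: complex_eq_iff)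
  also have "D \<dots> = - (of_real (Re w) * D 1 + of_real (Im w) * D \<i>)"
    using has_derivative_linear[OF D] by (simp only: linear_neg linear_add linear_cmul) (simp add: scaleR_conv_of_real)
  finally show ?thesis by (simp add: partial_eq_frechet_derivative[OF D])
qed

theorem theorem5p5:
  fixes f g :: "arrow \<Rightarrow> complex"
  assumes "smooth_arrow f" and "smooth_arrow g" and "compactly_supported g"
  shows "(\<lambda>x. (f \<star> g) (unit_at x) - (g \<star> f) (unit_at x)) has_renormalized_integral
    (- of_real pi * (LINT w|lborel.
       (let \<phi> = (\<lambda>\<zeta>. f (chart_xdot \<zeta> (cnj w)) * g (chart_xdot \<zeta> (- cnj w)))
        in of_real (Re w) * partial_x \<phi> 0 + of_real (Im w) * partial_y \<phi> 0)))"
    (is "_ has_renormalized_integral (- of_real pi * ?rhs)")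
proof -
  define F where "F = (\<lambda>(z, w). f (chart_xdot z w))"
  define G where "G = (\<lambda>(z, w). g (chart_xdot z w))"
  define k where "k = convolution_kernel f g"
  have F: "C_k (Suc (Suc 0)) F" and G: "C_k (Suc (Suc 0)) G"
    using assms(1,2) by (simp_all only: smooth_arrow_def smooth_def F_def G_def)
  note F1 = C_k_SucD[OF F] and G1 = C_k_SucD[OF G]
  have cont: "continuous_on UNIV (\<lambda>(z, w). f (chart_x z w))" "continuous_on UNIV (\<lambda>(z, w). g (chart_x z w))"
    using assms(1,2) C_k_continuous_on[of 0] unfolding smooth_arrow_def smooth_def by blast+
  obtain B where B: "1 \<le> B" and g0: "\<And>a. B < fibre_norm a \<Longrightarrow> g a = 0"
    using compactly_supported_fibre_norm[OF assms(3)] by blast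
  have k: "continuous_on UNIV (\<lambda>x. k (fst x) (snd x))"
  proof -
    have "continuous_on UNIV (\<lambda>x. (\<lambda>(z, w). f (chart_x z w)) (fst x + cnj (snd x), - snd x))"
      by (intro continuous_on_compose2[OF cont(1)] continuous_intros) auto
    moreover have "continuous_on UNIV (\<lambda>x. g (chart_x (fst x) (snd x)))"
      using cont(2) by (simp add: case_prod_beta')
    ultimately show ?thesis
      unfolding k_def convolution_kernel_def by (intro continuous_on_mult) simp_all
  qed
  have k0: "k z w = 0" if "B < cmod w" for z w
    using that by (simp add: k_def convolution_kernel_def g0)
  have G0: "G (\<zeta>, p) = 0" if "B < cmod p" for \<zeta> p
    using that by (simp add: G_def g0)
  \<comment> \<open>\<open>G\<close> vanishes on an open set containing \<open>(0, p)\<close>, hence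
    so does its derivative there; this confines the linear term to
    \<open>cmod p \<le> B\<close>.\<close>
  have DG0: "frechet_derivative G (at (0, p)) = (\<lambda>_. 0)" if "B < cmod p" for p
  proof (rule frechet_derivative_eq_0)
    show "open {x::complex \<times> complex. B < cmod (snd x)}"
      by (intro open_Collect_less continuous_intros)
  qed (use that G0 in auto)
  obtain M where M: "\<And>p \<zeta>. cmod p \<le> B \<Longrightarrow> cmod \<zeta> * B \<le> 1 / 2 \<Longrightarrow>
      cmod (leaf_kernel F G \<zeta> p - F (0, - p) * G (0, p) - leaf_linear_term F G p \<zeta>) \<le> M * (cmod \<zeta>)\<^sup>2"
    using leaf_kernel_expansion[OF F G B] by blast
  have rhs: "pi *\<^sub>R (LINT p|lborel. leaf_linear_term F G p (cnj p)) = - of_real pi * ?rhs"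
  proof -
    \<comment> \<open>The substitution \<open>p = - cnj w\<close> preserves Lebesgue measure and
      matches the fibre arguments in the stated formula.\<close>
    have "orthogonal_transformation (\<lambda>w. - cnj w)"
      using linear_compose_neg[OF bounded_linear.linear[OF bounded_linear_cnj]]
      by (simp add: orthogonal_transformation)
    moreover have "(\<lambda>p. leaf_linear_term F G p (cnj p)) \<in> borel_measurable borel"
      using continuous_on_compose2[OF leaf_linear_term_continuous[OF F1 G1], of UNIV "\<lambda>p. (p, cnj p)"]
      by (intro borel_measurable_continuous_onI) (simp add: continuous_intros)
    ultimately have "(LINT p|lborel. leaf_linear_term F G p (cnj p))
        = (LINT w|lborel. leaf_linear_term F G (- cnj w) (cnj (- cnj w)))"
      by (rule lborel_integral_orthogonal_transformation[symmetric])
    also have "\<dots> = - ?rhs"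
      unfolding leaf_linear_term_cnj[OF F1 G1]
      by (simp only: F_def G_def Let_def prod.case Bochner_Integration.integral_minus)
    finally show ?thesis by (simp add: scaleR_conv_of_real)
  qed
  have "(\<lambda>r. (LINT x|lborel. disc_diff r (fst x) (snd x) *\<^sub>R rotated k (fst x) (snd x))
      - pi *\<^sub>R (LINT p|lborel. leaf_linear_term F G p (cnj p))) \<in> O(\<lambda>r. of_real (1 / r))"
  proof (rule disc_diff_asymptotics[where \<Phi> = "\<lambda>p. F (0, - p) * G (0, p)" and M = M, OF B])
    show "continuous_on UNIV (\<lambda>p. F (0, - p) * G (0, p))"
      by (intro continuous_intros continuous_on_compose2[OF C_k_continuous_on[OF F, of UNIV]]
          continuous_on_compose2[OF C_k_continuous_on[OF G, of UNIV]]) auto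
    show "rotated k z p = 0" if "B < cmod p" for z p
      using that k0 by (auto simp: rotated_def norm_mult norm_divide)
    show "leaf_linear_term F G p \<zeta> = 0" if "B < cmod p" for p \<zeta>
      using that by (simp add: leaf_linear_term_def G0 DG0)
    show "cmod (rotated k z p - F (0, - p) * G (0, p) - leaf_linear_term F G p (1 / z)) \<le> M / (cmod z)\<^sup>2"
      if p: "cmod p \<le> B" and z: "2 * B \<le> cmod z" for z p
    proof -
      have z0: "z \<noteq> 0" using z B by auto
      \<comment> \<open>The two smallness conditions agree under \<open>\<zeta> = 1 / z\<close>;
        they also exclude \<open>1 + 1 / z * p = 0\<close>.\<close>
      have small: "cmod (1 / z) * B \<le> 1 / 2"
        using z z0 by (simp add: norm_divide field_simps)
      have "cmod (1 / z * p) \<le> cmod (1 / z) * B"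
        unfolding norm_mult using p by (intro mult_left_mono) auto
      with small have "cmod (1 / z * p) < 1" by linarith
      then have "1 + 1 / z * p \<noteq> 0"
        by (metis add_eq_0_iff2 norm_minus_cancel norm_one less_irrefl add.commute)
      then have "rotated k z p = leaf_kernel F G (1 / z) p"
        unfolding k_def F_def G_def by (rule rotated_convolution_kernel[OF z0])
      with M[OF p small] show ?thesis by (simp add: norm_divide power_divide)
    qed
    show "\<exists>C. \<forall>z p. cmod z \<le> R \<longrightarrow> cmod (rotated k z p) \<le> C" for R
      by (rule rotated_bounded[OF k k0])
  qed (auto simp: G0 intro: rotated_measurable k leaf_linear_term_continuous leaf_linear_term_linear F1 G1 simp del: C_k.simps)
  then have asymptotics: "(\<lambda>r. (LINT z:cball 0 r|lborel. (f \<star> g) (unit_at (cp1_z1 z)) - (g \<star> f) (unit_at (cp1_z1 z)))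
      - (- of_real pi * ?rhs)) \<in> O(\<lambda>r. of_real (1 / r))"
    unfolding convolution_commutator_unit k_def[symmetric] rhs by (simp add: cutoff_integral_eq(2)[OF k k0])
  have "set_integrable lborel (cball 0 r) (\<lambda>z. (f \<star> g) (unit_at (cp1_z1 z)) - (g \<star> f) (unit_at (cp1_z1 z)))" for r
    unfolding convolution_commutator_unit k_def[symmetric] by (rule cutoff_integral_eq(1)[OF k k0])
  then show ?thesis
    unfolding has_renormalized_integral_def
    \<comment> \<open>All divergent coefficients are \<open>0\<close>: the cutoff integrals of the
      commutator converge.\<close>
    by (intro conjI allI exI[of _ 0]) (use asymptotics in simp_all)
qed

end
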